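(* Let $\mathbf{X}_1,\mathbf{X}_2,\dots$ be i.i.d. random vectors with an absolutely continuous distribution on $\mathbb{R}^d$ which is centrally symmetric around $\boldsymbol{0}$. For each $n$ let $\mathbf{F}_{\pm,a}^{(n)}$ be the empirical center-outward distribution function computed from the symmetrized sample $\{\mathbf{X}_1,\dots,\mathbf{X}_n,-\mathbf{X}_1,\dots,-\mathbf{X}_n\}$ with values in a grid $\mathcal{G}_{2n}$ of $2n$ points satisfying $\mathbf{g}\in\mathcal{G}_{2n}\Rightarrow-\mathbf{g}\in\mathcal{G}_{2n}$, let $\mathbf{S}_{\pm,a}(\mathbf{X}_i)$ be the corresponding center-outward signs, and put $$\mathbf{T}_{S,a}=\frac{1}{\sqrt n}\sum_{i=1}^n\mathbf{S}_{\pm,a}(\mathbf{X}_i),\qquad \mathbf{T}_{F,a}=\frac{1}{\sqrt n}\sum_{i=1}^n\mathbf{F}_{\pm,a}^{(n)}(\mathbf{X}_i).$$ Then, as $n\to\infty$, $$d\,\|\mathbf{T}_{S,a}\|^2=\frac dn\left\|\sum_{i=1}^n\mathbf{S}_{\pm,a}(\mathbf{X}_i)\right\|^2\to\chi^2_d\quad\text{in distribution}$$ and $$3d\,\|\mathbf{T}_{F,a}\|^2=\frac{3d}{n}\left\|\sum_{i=1}^n\mathbf{F}_{\pm,a}^{(n)}(\mathbf{X}_i)\right\|^2\to\chi^2_d\quad\text{in distribution},$$ where $\chi^2_d$ is the chi-square distribution with $d$ degrees of freedom.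
   Context: A distribution of $\mathbf{X}$ is centrally symmetric around $\boldsymbol{0}$ if $\mathrm{P}[\mathbf{X}\in A]=\mathrm{P}[-\mathbf{X}\in A]$ for all Borel $A\subseteq\mathbb{R}^d$. $U_d$ denotes the distribution of $R\mathbf{Z}$ with $R$ and $\mathbf{Z}$ independent, $R$ uniform on $[0,1]$, $\mathbf{Z}$ uniform on the unit sphere of $\mathbb{R}^d$. The grid $\mathcal{G}_{2n}$ is a deterministic collection of $2n$ points in the closed unit ball of $\mathbb{R}^d$, pairwise distinct except that $\boldsymbol{0}$ may be repeated, and it is assumed throughout that the discrete uniform distribution on $\mathcal{G}_{2n}$ converges weakly to $U_d$ as $n\to\infty$. $\mathbf{F}_{\pm,a}^{(n)}$ is a one-to-one assignment $g$ of the $2n$ points $\mathbf{X}_1,\dots,\mathbf{X}_n,-\mathbf{X}_1,\dots,-\mathbf{X}_n$ to the $2n$ points of $\mathcal{G}_{2n}$ which minimizes $$\sum_{i=1}^n\|\mathbf{X}_i-g(\mathbf{X}_i)\|^2+\sum_{i=1}^n\|-\mathbf{X}_i-g(-\mathbf{X}_i)\|^2$$ over all such assignments. The center-outward sign is $\mathbf{S}_{\pm,a}(\mathbf{x})=\mathbf{F}_{\pm,a}^{(n)}(\mathbf{x})/\|\mathbf{F}_{\pm,a}^{(n)}(\mathbf{x})\|$ if $\mathbf{F}_{\pm,a}^{(n)}(\mathbf{x})\neq\boldsymbol{0}$, and $\boldsymbol{0}$ otherwise. *)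

theory Defs
  imports "HOL-Probability.Probability"
begin

text \<open>Probability measures on \<open>\<real>\<^sup>d\<close> are measures with the Borel sigma-algebra. The library's
  \<^const>\<open>weak_conv_m\<close> covers measures on \<open>\<real>\<close> only; for \<open>\<real>\<^sup>d\<close> weak convergence is expressed by bounded
  continuous test functions.\<close>

definition weakly_converges :: "(nat \<Rightarrow> 'a::topological_space measure) \<Rightarrow> 'a measure \<Rightarrow> bool" where
  "weakly_converges \<mu> \<nu> \<longleftrightarrow>
     (\<forall>f :: 'a \<Rightarrow> real. continuous_on UNIV f \<longrightarrow> bounded (range f) \<longrightarrow>
        (\<lambda>n. \<integral>x. f x \<partial>\<mu> n) \<longlonglongrightarrow> (\<integral>x. f x \<partial>\<nu>))"

definition centrally_symmetric :: "'a::euclidean_space measure \<Rightarrow> bool" where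
  "centrally_symmetric P \<longleftrightarrow> (\<forall>A \<in> sets borel. measure P A = measure P {x. - x \<in> A})"

text \<open>The uniform distribution on the unit sphere is the law of \<open>Y / \<parallel>Y\<parallel>\<close> with \<open>Y\<close> uniform on the unit
  ball (the normalized cone measure, which for the Euclidean norm is normalized surface measure);
  for \<open>d = 1\<close> it is uniform on \<open>{-1, 1}\<close>. Recall that \<open>sgn v = v / \<parallel>v\<parallel>\<close> and \<open>sgn 0 = 0\<close>.\<close>

definition uniform_sphere :: "'a::euclidean_space measure" where
  "uniform_sphere = distr (uniform_measure lborel (ball 0 1)) borel sgn"

definition spherical_uniform :: "'a::euclidean_space measure" where
  "spherical_uniform =
     distr (uniform_measure lborel {0..1::real} \<Otimes>\<^sub>M uniform_sphere) borel (\<lambda>(r, z). r *\<^sub>R z)"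

definition chi_square :: "nat \<Rightarrow> real measure" where
  "chi_square d =
     distr (\<Pi>\<^sub>M i\<in>{..<d}. std_normal_distribution) borel (\<lambda>z. \<Sum>i<d. (z i)\<^sup>2)"

text \<open>A grid is a multiset because the origin may be repeated.\<close>

definition is_grid :: "nat \<Rightarrow> 'a::euclidean_space multiset \<Rightarrow> bool" where
  "is_grid N G \<longleftrightarrow> size G = N \<and> set_mset G \<subseteq> cball 0 1 \<and> (\<forall>g. g \<noteq> 0 \<longrightarrow> count G g \<le> 1)"

definition grid_distribution :: "'a::euclidean_space multiset \<Rightarrow> 'a measure" where
  "grid_distribution G = distr (measure_pmf (pmf_of_multiset G)) borel (\<lambda>g. g)"

text \<open>A sample of size \<open>n\<close> is \<open>x 0, \<dots>, x (n - 1)\<close>.\<close>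

definition symmetrized_sample :: "nat \<Rightarrow> (nat \<Rightarrow> 'a::euclidean_space) \<Rightarrow> 'a multiset" where
  "symmetrized_sample n x = {# x i. i \<in># mset_set {..<n} #} + {# - x i. i \<in># mset_set {..<n} #}"

text \<open>Equality of multisets makes \<open>g\<close> a one-to-one assignment that uses every grid point exactly as
  often as it occurs in the grid. Only the values of \<open>g\<close> on the sample points matter.\<close>

definition is_assignment ::
    "'a::euclidean_space multiset \<Rightarrow> nat \<Rightarrow> (nat \<Rightarrow> 'a) \<Rightarrow> ('a \<Rightarrow> 'a) \<Rightarrow> bool" where
  "is_assignment G n x g \<longleftrightarrow> image_mset g (symmetrized_sample n x) = G"

definition transport_cost :: "nat \<Rightarrow> (nat \<Rightarrow> 'a::euclidean_space) \<Rightarrow> ('a \<Rightarrow> 'a) \<Rightarrow> real" where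
  "transport_cost n x g =
     (\<Sum>i<n. (norm (x i - g (x i)))\<^sup>2) + (\<Sum>i<n. (norm (- x i - g (- x i)))\<^sup>2)"

definition is_empirical_center_outward ::
    "'a::euclidean_space multiset \<Rightarrow> nat \<Rightarrow> (nat \<Rightarrow> 'a) \<Rightarrow> ('a \<Rightarrow> 'a) \<Rightarrow> bool" where
  "is_empirical_center_outward G n x F \<longleftrightarrow>
     is_assignment G n x F \<and>
     (\<forall>g. is_assignment G n x g \<longrightarrow> transport_cost n x F \<le> transport_cost n x g)"

definition center_outward_sign :: "('a::euclidean_space \<Rightarrow> 'a) \<Rightarrow> 'a \<Rightarrow> 'a" where
  "center_outward_sign F x = (if F x \<noteq> 0 then F x /\<^sub>R norm (F x) else 0)"

definition T_sign :: "nat \<Rightarrow> (nat \<Rightarrow> 'a::euclidean_space) \<Rightarrow> ('a \<Rightarrow> 'a) \<Rightarrow> 'a" where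
  "T_sign n x F = (1 / sqrt (real n)) *\<^sub>R (\<Sum>i<n. center_outward_sign F (x i))"

definition T_distribution :: "nat \<Rightarrow> (nat \<Rightarrow> 'a::euclidean_space) \<Rightarrow> ('a \<Rightarrow> 'a) \<Rightarrow> 'a" where
  "T_distribution n x F = (1 / sqrt (real n)) *\<^sub>R (\<Sum>i<n. F (x i))"

lemma emeasure_unit_ball:
  "emeasure lborel (ball (0::'a::euclidean_space) 1) \<noteq> 0"
  "emeasure lborel (ball (0::'a::euclidean_space) 1) < \<infinity>"
proof -
  show "emeasure lborel (ball (0::'a) 1) < \<infinity>"
    by (intro emeasure_bounded_finite) simp
  have "ball (0::'a) 1 \<notin> null_sets lborel"
    using open_not_negligible[of "ball (0::'a) 1"]
    by (auto simp: negligible_iff_null_sets intro: null_sets_completionI)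
  then show "emeasure lborel (ball (0::'a) 1) \<noteq> 0"
    by (auto simp: null_sets_def)
qed

lemma prob_space_uniform_sphere: "prob_space (uniform_sphere :: 'a::euclidean_space measure)"
proof -
  interpret U: prob_space "uniform_measure lborel (ball (0::'a) 1)"
    using emeasure_unit_ball[where 'a='a] by (intro prob_space_uniform_measure) auto
  show ?thesis
    unfolding uniform_sphere_def by (rule U.prob_space_distr) measurable
qed

lemma AE_uniform_sphere_norm: "AE z in (uniform_sphere :: 'a::euclidean_space measure). norm z = 1"
proof -
  have "AE x in lborel. x \<noteq> (0::'a)"
    by (rule AE_lborel_singleton)
  then have "AE x in lborel. x \<in> ball (0::'a) 1 \<longrightarrow> norm (sgn x) = 1"
    by eventually_elim (auto simp: norm_sgn)
  then have "AE x in uniform_measure lborel (ball (0::'a) 1). norm (sgn x) = 1"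
    by (intro AE_uniform_measureI) auto
  then show ?thesis
    unfolding uniform_sphere_def by (subst AE_distr_iff) auto
qed

end

theory Submission
  imports Defs
begin

text \<open>
  Why the theorem holds. Once the optimal assignment is known to be odd, the statistics become
  Rademacher sums with deterministic coefficients, and the chi-square limit is an averaged central
  limit theorem.

  \<^bold>\<open>Oddness.\<close> Since the sample is symmetrized and the grid is symmetric, an optimal assignment
  induces one matching of the grid, between its values at \<open>x i\<close> and \<open>- x i\<close>, while opposite grid points
  form another. The union of the two matchings splits into cycles; orienting them
  (\<open>balanced_orientation\<close>, \<open>symmetric_halves\<close>) yields two odd assignments whose
  costs average to that of the given optimal one, so both are optimal. For an
  absolutely continuous law, distinct odd assignments almost surely have distinct costs, so the
  two coincide; then the optimal assignment is odd, and it is determined on the sample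
  (\<open>optimal_assignment_is_odd\<close>).

  \<^bold>\<open>Random signs.\<close> Changing the signs of some sample points leaves the law of the sample unchanged
  and changes the signs of the corresponding values of the optimal assignment. Hence, up to averaging
  over finitely many odd assignments \<open>a\<close>, the sum of the \<open>F (X i)\<close> is distributed like
  \<open>\<Sum>i<n. s i *\<^sub>R a i\<close> with independent random signs \<open>s i\<close>
  (\<open>expectation_center_outward_signs\<close>).

  \<^bold>\<open>Gaussian limit.\<close> For a standard Gaussian vector \<open>z\<close>, the identity
  \<open>exp (- \<kappa> * (norm y)\<^sup>2) = E cos (z \<bullet> (sqrt (2 * \<kappa>) *\<^sub>R y))\<close> turns the Laplace transform of the squared
  norm of a Rademacher sum into the Gaussian expectation of a product of cosines, which is close to
  \<open>exp (- \<kappa> * q z)\<close>. Here \<open>q z\<close> is the second moment of the grid in direction \<open>z\<close>: it depends on the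
  grid only, not on \<open>a\<close> (\<open>average_laplace_signs_gaussian_bound\<close>).

  \<^bold>\<open>Second moments.\<close> Weak convergence of the grids and the rotational symmetry of the sphere give
  \<open>q z \<longlonglongrightarrow> (norm z)\<^sup>2 / (3 * d)\<close>, the factor \<open>1 / 3\<close> being the second moment of the uniform radius,
  and \<open>(norm z)\<^sup>2 / d\<close> when grid points are replaced by their directions. Consequently the Laplace
  transforms converge to that of the squared norm of a Gaussian vector, and convergence of Laplace
  transforms gives weak convergence (\<open>weak_conv_m_of_laplace_transforms\<close>).
\<close>

section \<open>Weak convergence from Laplace transforms\<close>

text \<open>Substitute \<open>u = exp (- w)\<close>: the Laplace transform at \<open>k\<close> becomes the \<open>k\<close>-th moment of a law on
  \<open>{0..1}\<close>. A step function that vanishes for large \<open>w\<close> becomes a continuous function of \<open>u\<close> which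
  is \<open>0\<close> near \<open>u = 0\<close>, so that it is a uniform limit of polynomials on \<open>{0..1}\<close>. Continuity
  at \<open>u = 0\<close> is what controls mass escaping to infinity.\<close>

lemma weak_conv_m_of_laplace_transforms:
  fixes \<mu> :: "nat \<Rightarrow> real measure" and \<nu> :: "real measure"
  assumes "\<And>n. real_distribution (\<mu> n)" and "real_distribution \<nu>"
    and nonneg: "\<And>n. AE w in \<mu> n. 0 \<le> w" "AE w in \<nu>. 0 \<le> w"
    and laplace: "\<And>k::nat. (\<lambda>n. \<integral>w. exp (- real k * w) \<partial>\<mu> n) \<longlonglongrightarrow> (\<integral>w. exp (- real k * w) \<partial>\<nu>)"
  shows "weak_conv_m \<mu> \<nu>"
proof (rule integral_cts_step_conv_imp_weak_conv)
  show "real_distribution (\<mu> n)" for n by fact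
  show "real_distribution \<nu>" by fact
next
  fix x y :: real assume xy: "x < y"
  \<comment> \<open>the step function in the variable \<open>u = exp (- w)\<close>\<close>
  define h where "h u = (if u \<le> 0 then 0 else cts_step x y (- ln u))" for u
  have h_exp: "h (exp (- w)) = cts_step x y w" for w by (simp add: h_def)
  have cont_step: "continuous_on UNIV (cts_step x y)"
    using cts_step_uniformly_continuous[OF xy] uniformly_continuous_imp_continuous by blast
  have "continuous_on UNIV h"
  proof -
    have "continuous_on ({..exp (- y)} \<union> {exp (- y)..}) h"
    proof (rule continuous_on_closed_Un)
      have "h u = 0" if "u \<le> exp (- y)" for u
      proof (cases "u \<le> 0")
        case False
        then have "ln u \<le> - y" using that 
          by (metis ln_exp ln_le_cancel_iff exp_gt_zero not_le)
        then show ?thesis using xy False by (simp add: h_def cts_step_def)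
      qed (simp add: h_def)
      then show "continuous_on {..exp (- y)} h"
        by (subst continuous_on_cong[OF refl, where g = "\<lambda>_. 0"]) auto
      have "continuous_on {exp (- y)..} (\<lambda>u. cts_step x y (- ln u))"
        by (intro continuous_on_compose2[OF cont_step] continuous_intros)
           (auto dest!: order.strict_trans2[OF exp_gt_zero])
      moreover have "h u = cts_step x y (- ln u)" if "u \<in> {exp (- y)..}" for u
        using that exp_gt_zero[of "- y"] by (simp add: h_def del: exp_gt_zero)
      ultimately show "continuous_on {exp (- y)..} h"
        by (subst continuous_on_cong[OF refl, where g = "\<lambda>u. cts_step x y (- ln u)"]) auto
    qed auto
    moreover have "{..exp (- y)} \<union> {exp (- y)..} = UNIV" by auto
    ultimately show ?thesis by simp
  qed
  then have cont_h: "continuous_on {0..1} h" by (rule continuous_on_subset) simp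
  have approx: "\<exists>a N. \<forall>\<kappa>. real_distribution \<kappa> \<longrightarrow> (AE w in \<kappa>. 0 \<le> w) \<longrightarrow>
      \<bar>(\<integral>w. cts_step x y w \<partial>\<kappa>) - (\<Sum>k\<le>N::nat. a k * (\<integral>w. exp (- real k * w) \<partial>\<kappa>))\<bar> \<le> e"
    if "0 < e" for e
  proof -
    obtain g where g: "real_polynomial_function g" "\<And>u. u \<in> {0..1} \<Longrightarrow> \<bar>h u - g u\<bar> < e"
      using Stone_Weierstrass_real_polynomial_function[OF compact_Icc cont_h \<open>0 < e\<close>] by metis
    obtain a N where g_eq: "g = (\<lambda>u. \<Sum>k\<le>N. a k * u ^ k)"
      using g(1) by (auto simp: real_polynomial_function_iff_sum)
    have "\<bar>(\<integral>w. cts_step x y w \<partial>\<kappa>) - (\<Sum>k\<le>N. a k * (\<integral>w. exp (- real k * w) \<partial>\<kappa>))\<bar> \<le> e"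
      if "real_distribution \<kappa>" and \<kappa>: "AE w in \<kappa>. 0 \<le> w" for \<kappa>
    proof -
      interpret K: real_distribution \<kappa> by fact
      have int: "integrable \<kappa> (\<lambda>w. exp (- real k * w))" for k
        using \<kappa> by (intro K.integrable_const_bound[of _ 1]) auto
      have "(\<Sum>k\<le>N. a k * (\<integral>w. exp (- real k * w) \<partial>\<kappa>)) = (\<integral>w. (\<Sum>k\<le>N. a k * exp (- real k * w)) \<partial>\<kappa>)"
        using int by simp
      then have "(\<integral>w. cts_step x y w \<partial>\<kappa>) - (\<Sum>k\<le>N. a k * (\<integral>w. exp (- real k * w) \<partial>\<kappa>))
          = (\<integral>w. (cts_step x y w - (\<Sum>k\<le>N. a k * exp (- real k * w))) \<partial>\<kappa>)"
        using int K.integrable_cts_step[OF xy] by simp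
      also have "\<bar>\<dots>\<bar> \<le> (\<integral>w. \<bar>cts_step x y w - (\<Sum>k\<le>N. a k * exp (- real k * w))\<bar> \<partial>\<kappa>)"
        by (rule integral_abs_bound)
      also have "\<dots> \<le> (\<integral>w. e \<partial>\<kappa>)"
      proof (rule integral_mono_AE)
        show "AE w in \<kappa>. \<bar>cts_step x y w - (\<Sum>k\<le>N. a k * exp (- real k * w))\<bar> \<le> e"
          using \<kappa>
        proof eventually_elim
          case (elim w)
          then have "\<bar>h (exp (- w)) - g (exp (- w))\<bar> < e" by (intro g(2)) simp
          then show ?case by (simp add: h_exp g_eq flip: exp_of_nat_mult)
        qed
      qed (use int K.integrable_cts_step[OF xy] in simp_all)
      also have "\<dots> = e" using K.prob_space by simp
      finally show ?thesis .
    qed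
    then show ?thesis by blast
  qed
  show "(\<lambda>n. integral\<^sup>L (\<mu> n) (cts_step x y)) \<longlonglongrightarrow> integral\<^sup>L \<nu> (cts_step x y)"
  proof (rule LIMSEQ_I)
    fix e :: real assume "0 < e"
    then obtain a N where aN: "\<And>\<kappa>. real_distribution \<kappa> \<Longrightarrow> (AE w in \<kappa>. 0 \<le> w) \<Longrightarrow>
      \<bar>(\<integral>w. cts_step x y w \<partial>\<kappa>) - (\<Sum>k\<le>N::nat. a k * (\<integral>w. exp (- real k * w) \<partial>\<kappa>))\<bar> \<le> e / 3"
      using approx[of "e / 3"] by auto
    have conv: "(\<lambda>n. \<Sum>k\<le>N. a k * (\<integral>w. exp (- real k * w) \<partial>\<mu> n))
        \<longlonglongrightarrow> (\<Sum>k\<le>N. a k * (\<integral>w. exp (- real k * w) \<partial>\<nu>))"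
      by (intro tendsto_intros laplace)
    obtain n0 where n0: "\<And>n. n \<ge> n0 \<Longrightarrow>
        \<bar>(\<Sum>k\<le>N. a k * (\<integral>w. exp (- real k * w) \<partial>\<mu> n)) - (\<Sum>k\<le>N. a k * (\<integral>w. exp (- real k * w) \<partial>\<nu>))\<bar> < e / 3"
      using LIMSEQ_D[OF conv, of "e / 3"] \<open>0 < e\<close> by auto
    show "\<exists>n0. \<forall>n\<ge>n0. norm (integral\<^sup>L (\<mu> n) (cts_step x y) - integral\<^sup>L \<nu> (cts_step x y)) < e"
    proof (intro exI allI impI)
      fix n assume "n \<ge> n0"
      then show "norm (integral\<^sup>L (\<mu> n) (cts_step x y) - integral\<^sup>L \<nu> (cts_step x y)) < e"
        using n0[of n] aN[OF assms(1) nonneg(1), of n] aN[OF assms(2) nonneg(2)]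
        unfolding real_norm_def by linarith
    qed
  qed
qed

section \<open>Rademacher sums and Gaussian vectors\<close>

text \<open>Both functions agree with \<open>1 - u\<^sup>2 / 2\<close> up to fourth order.\<close>

lemma cos_minus_exp_bound: "\<bar>cos u - exp (- (u\<^sup>2 / 2))\<bar> \<le> u ^ 4" for u :: real
proof -
  have "cmod (iexp u - (\<Sum>k \<le> 3. (\<i> * u)^k / fact k)) \<le> \<bar>u\<bar>^(Suc 3) / fact (Suc 3)"
    by (rule iexp_approx1)
  then have "\<bar>Re (iexp u - (\<Sum>k \<le> 3. (\<i> * u)^k / fact k))\<bar> \<le> \<bar>u\<bar>^(Suc 3) / fact (Suc 3)"
    using abs_Re_le_cmod order_trans by blast
  moreover have "Re (iexp u - (\<Sum>k \<le> 3. (\<i> * u)^k / fact k)) = cos u - (1 - u\<^sup>2 / 2)"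
    by (simp add: numeral_3_eq_3 fact_numeral power2_eq_square field_simps Re_exp)
  ultimately have 1: "\<bar>cos u - (1 - u\<^sup>2 / 2)\<bar> \<le> u ^ 4 / 24"
    by (simp add: fact_numeral power_even_abs)
  have "1 - u\<^sup>2 / 2 \<le> exp (- (u\<^sup>2 / 2))"
    using exp_ge_add_one_self[of "- (u\<^sup>2 / 2)"] by simp
  moreover have "exp (- v) \<le> 1 - v + v\<^sup>2 / 2" if "v \<ge> 0" for v :: real
  proof -
    \<comment> \<open>\<open>1 + v + v\<^sup>2 / 2\<close> bounds \<open>exp v\<close> from below, so a product of at least \<open>1\<close> bounds its inverse\<close>
    have "(1 - v + v\<^sup>2 / 2) * (1 + v + v\<^sup>2 / 2) = 1 + v ^ 4 / 4"
      by (simp add: field_simps power2_eq_square power4_eq_xxxx)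
    then have ge1: "(1 - v + v\<^sup>2 / 2) * (1 + v + v\<^sup>2 / 2) \<ge> 1" by simp
    have pos: "0 < 1 - v + v\<^sup>2 / 2"
    proof -
      have "1 - v + v\<^sup>2 / 2 = (1 + (1 - v)\<^sup>2) / 2" by (simp add: power2_eq_square field_simps)
      moreover have "0 < (1 + (1 - v)\<^sup>2) / 2" by (simp add: add_pos_nonneg)
      ultimately show ?thesis by simp
    qed
    have "1 \<le> (1 - v + v\<^sup>2 / 2) * exp v"
      using ge1 mult_left_mono[OF exp_lower_Taylor_quadratic[OF that] less_imp_le[OF pos]] by linarith
    then show ?thesis by (simp add: exp_minus field_simps)
  qed
  from this[of "u\<^sup>2 / 2"] have "exp (- (u\<^sup>2 / 2)) \<le> 1 - u\<^sup>2 / 2 + u ^ 4 / 8"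
    by (simp add: power_divide flip: power_mult)
  moreover have "0 \<le> u ^ 4" by simp
  ultimately show ?thesis using 1 unfolding abs_le_iff by linarith
qed

lemma prod_cos_minus_exp_bound:
  fixes u :: "'i \<Rightarrow> real"
  shows "\<bar>(\<Prod>i\<in>I. cos (u i)) - exp (- ((\<Sum>i\<in>I. (u i)\<^sup>2) / 2))\<bar> \<le> (\<Sum>i\<in>I. u i ^ 4)"
proof (cases "finite I")
  case True
  have "exp (- ((\<Sum>i\<in>I. (u i)\<^sup>2) / 2)) = (\<Prod>i\<in>I. exp (- ((u i)\<^sup>2 / 2)))"
    using True by (simp add: exp_sum sum_divide_distrib flip: sum_negf)
  then have "\<bar>(\<Prod>i\<in>I. cos (u i)) - exp (- ((\<Sum>i\<in>I. (u i)\<^sup>2) / 2))\<bar>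
      \<le> (\<Sum>i\<in>I. \<bar>cos (u i) - exp (- ((u i)\<^sup>2 / 2))\<bar>)"
    using norm_prod_diff[of I "\<lambda>i. cos (u i)" "\<lambda>i. exp (- ((u i)\<^sup>2 / 2))"] by simp
  also have "\<dots> \<le> (\<Sum>i\<in>I. u i ^ 4)" by (intro sum_mono cos_minus_exp_bound)
  finally show ?thesis .
qed simp

definition signs :: "nat \<Rightarrow> (nat \<Rightarrow> real) set" where
  "signs n = {..<n} \<rightarrow>\<^sub>E {1, -1}"

lemma finite_signs [simp]: "finite (signs n)" and card_signs [simp]: "card (signs n) = 2 ^ n"
  by (simp_all add: signs_def finite_PiE card_PiE numeral_2_eq_2)

text \<open>The characteristic function of a Rademacher sum, whose factors are \<open>cos (u i)\<close>.\<close>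

lemma average_cos_signs:
  "(\<Sum>s\<in>signs n. cos (\<Sum>i<n. s i * u i)) / 2 ^ n = (\<Prod>i<n. cos (u i))"
proof -
  have "(\<Prod>i<n. \<Sum>t\<in>{1, -1::real}. cis (t * u i)) = (\<Sum>s\<in>signs n. \<Prod>i<n. cis (s i * u i))"
    unfolding signs_def by (rule prod_sum_PiE) auto
  moreover have "(\<Sum>t\<in>{1, -1::real}. cis (t * u i)) = complex_of_real (2 * cos (u i))" for i
    by (simp add: complex_eq_iff)
  moreover have "(\<Prod>i<n. cis (s i * u i)) = cis (\<Sum>i<n. s i * u i)" for s
    by (simp add: cis_conv_exp exp_sum sum_distrib_left)
  ultimately have "complex_of_real (2 ^ n * (\<Prod>i<n. cos (u i))) = (\<Sum>s\<in>signs n. cis (\<Sum>i<n. s i * u i))"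
    by (simp add: prod.distrib)
  then have "Re (complex_of_real (2 ^ n * (\<Prod>i<n. cos (u i)))) = Re (\<Sum>s\<in>signs n. cis (\<Sum>i<n. s i * u i))"
    by (rule arg_cong)
  then show ?thesis unfolding Re_complex_of_real by (simp add: field_simps)
qed

text \<open>The coordinates of the vector are enumerated by \<open>{..<CARD('d)}\<close>, the index set of the
  product measure in \<open>chi_square CARD('d)\<close>, so that the squared norm has that law.\<close>

definition std_gaussian :: "(real ^ 'd) measure" where
  "std_gaussian = distr (\<Pi>\<^sub>M i\<in>{..<CARD('d)}. std_normal_distribution) borel
     (\<lambda>z. \<chi> j. z (to_nat_on (UNIV :: 'd set) j))"

lemma bij_to_nat_on: "bij_betw (to_nat_on (UNIV :: 'd::finite set)) UNIV {..<CARD('d)}"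
  by (rule to_nat_on_finite) simp

lemma measurable_gaussian_vector [measurable]:
  "(\<lambda>z. \<chi> j. z (to_nat_on (UNIV :: 'd::finite set) j))
     \<in> borel_measurable (\<Pi>\<^sub>M i\<in>{..<CARD('d)}. std_normal_distribution)"
proof -
  have "to_nat_on (UNIV :: 'd::finite set) j < CARD('d)" for j
    using bij_to_nat_on[where 'd='d] by (auto simp: bij_betw_def)
  then have 1: "(\<lambda>z. z (to_nat_on (UNIV :: 'd set) j)) \<in> borel_measurable (\<Pi>\<^sub>M i\<in>{..<CARD('d)}. std_normal_distribution)" for j
    using measurable_component_singleton[of "to_nat_on (UNIV :: 'd set) j" "{..<CARD('d)}" "\<lambda>_. std_normal_distribution"]
    by simp
  have "(\<lambda>z. \<Sum>j\<in>UNIV. z (to_nat_on (UNIV :: 'd set) j) *\<^sub>R axis j (1::real))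
      \<in> borel_measurable (\<Pi>\<^sub>M i\<in>{..<CARD('d)}. std_normal_distribution)"
    using 1 by measurable
  also have "(\<lambda>z. \<Sum>j\<in>UNIV. z (to_nat_on (UNIV :: 'd set) j) *\<^sub>R axis j (1::real))
     = (\<lambda>z. \<chi> j. z (to_nat_on (UNIV :: 'd set) j))"
    by (auto simp: vec_eq_iff axis_def if_distrib cong: if_cong)
  finally show ?thesis .
qed

lemma product_prob_space_std_normal: "product_prob_space (\<lambda>_. std_normal_distribution)"
  by (simp add: product_prob_space_def product_prob_space_axioms_def product_sigma_finite_def
      prob_space_normal_density prob_space_imp_sigma_finite)

lemma prob_space_std_gaussian: "prob_space (std_gaussian :: (real ^ 'd) measure)"
proof -
  interpret product_prob_space "\<lambda>_::nat. std_normal_distribution" "{..<CARD('d)}"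
    by (rule product_prob_space_std_normal)
  show ?thesis unfolding std_gaussian_def by (intro prob_space_distr measurable_gaussian_vector)
qed

lemma sets_std_gaussian [simp, measurable_cong]: "sets std_gaussian = sets borel"
  and space_std_gaussian [simp]: "space std_gaussian = UNIV"
  by (simp_all add: std_gaussian_def)

lemma chi_square_eq_distr_std_gaussian:
  "chi_square CARD('d) = distr (std_gaussian :: (real ^ 'd) measure) borel (\<lambda>z. (norm z)\<^sup>2)"
proof -
  have "(norm (\<chi> j. z (to_nat_on (UNIV :: 'd set) j)))\<^sup>2 = (\<Sum>i<CARD('d). (z i)\<^sup>2)" for z :: "nat \<Rightarrow> real"
    using sum.reindex_bij_betw[OF bij_to_nat_on[where 'd='d], of "\<lambda>i. (z i)\<^sup>2"]
    by (simp add: norm_vec_def L2_set_def sum_nonneg)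
  then show ?thesis
    unfolding chi_square_def std_gaussian_def by (subst distr_distr) (auto simp: comp_def)
qed

lemma integral_cos_std_gaussian:
  "(\<integral>z. cos (z \<bullet> y) \<partial>(std_gaussian :: (real ^ 'd) measure)) = exp (- ((norm y)\<^sup>2 / 2))"
proof -
  interpret N: real_distribution std_normal_distribution by (rule real_dist_normal_dist)
  interpret P: product_prob_space "\<lambda>_::nat. std_normal_distribution" "{..<CARD('d)}"
    by (rule product_prob_space_std_normal)
  interpret G: prob_space "std_gaussian :: (real ^ 'd) measure" by (rule prob_space_std_gaussian)
  let ?e = "to_nat_on (UNIV :: 'd set)"
  define c where "c i = y $ inv_into UNIV ?e i" for i
  have c: "y $ j = c (?e j)" for j
    using bij_to_nat_on[where 'd='d] by (simp add: c_def bij_betw_def inv_into_f_f)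
  have "(\<integral>z. iexp (z \<bullet> y) \<partial>(std_gaussian :: (real ^ 'd) measure))
      = (\<integral>z. iexp ((\<chi> j. z (?e j)) \<bullet> y) \<partial>(\<Pi>\<^sub>M i\<in>{..<CARD('d)}. std_normal_distribution))"
    unfolding std_gaussian_def by (subst integral_distr) auto
  also have "\<dots> = (\<integral>z. (\<Prod>i<CARD('d). iexp (c i * z i)) \<partial>(\<Pi>\<^sub>M i\<in>{..<CARD('d)}. std_normal_distribution))"
  proof (intro Bochner_Integration.integral_cong refl)
    fix z :: "nat \<Rightarrow> real"
    have "(\<chi> j. z (?e j)) \<bullet> y = (\<Sum>i<CARD('d). c i * z i)"
      using sum.reindex_bij_betw[OF bij_to_nat_on[where 'd='d], of "\<lambda>i. c i * z i"]
      by (simp add: inner_vec_def c mult.commute)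
    then show "iexp ((\<chi> j. z (?e j)) \<bullet> y) = (\<Prod>i<CARD('d). iexp (c i * z i))"
      by (simp add: sum_distrib_left exp_sum)
  qed
  also have "\<dots> = (\<Prod>i<CARD('d). char std_normal_distribution (c i))"
    unfolding char_def by (rule P.product_integral_prod) (auto intro: N.integrable_iexp)
  also have "\<dots> = complex_of_real (exp (- ((\<Sum>i<CARD('d). (c i)\<^sup>2) / 2)))"
    by (simp add: char_std_normal_distribution sum_divide_distrib sum_negf[symmetric] exp_sum)
  also have "(\<Sum>i<CARD('d). (c i)\<^sup>2) = (norm y)\<^sup>2"
    using sum.reindex_bij_betw[OF bij_to_nat_on[where 'd='d], of "\<lambda>i. (c i)\<^sup>2"]
    by (simp add: norm_vec_def L2_set_def sum_nonneg c)
  finally have eq: "(\<integral>z. iexp (z \<bullet> y) \<partial>(std_gaussian :: (real ^ 'd) measure))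
      = complex_of_real (exp (- ((norm y)\<^sup>2 / 2)))" .
  have "integrable (std_gaussian :: (real ^ 'd) measure) (\<lambda>z. iexp (z \<bullet> y))"
    by (intro G.integrable_const_bound[of _ 1]) auto
  from integral_Re[OF this] show ?thesis by (simp add: eq Re_exp del: of_real_exp flip: of_real_exp)
qed

text \<open>The function \<open>exp (- \<kappa> * (norm y)\<^sup>2)\<close> is the characteristic function of a Gaussian vector at
  \<open>sqrt (2 * \<kappa>) *\<^sub>R y\<close>. This linearizes the squared norm, and for a fixed Gaussian vector the
  independent signs factorize.\<close>

lemma average_laplace_signs:
  fixes y :: "nat \<Rightarrow> real ^ 'd"
  assumes "\<kappa> \<ge> 0"
  shows "(\<Sum>s\<in>signs n. exp (- \<kappa> * (norm (\<Sum>i<n. s i *\<^sub>R y i))\<^sup>2)) / 2 ^ n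
    = (\<integral>z. (\<Prod>i<n. cos (sqrt (2 * \<kappa>) * (z \<bullet> y i))) \<partial>std_gaussian)"
proof -
  interpret G: prob_space "std_gaussian :: (real ^ 'd) measure" by (rule prob_space_std_gaussian)
  have "(\<integral>z. (\<Prod>i<n. cos (sqrt (2 * \<kappa>) * (z \<bullet> y i))) \<partial>std_gaussian)
     = (\<integral>z. (\<Sum>s\<in>signs n. cos (z \<bullet> (sqrt (2 * \<kappa>) *\<^sub>R (\<Sum>i<n. s i *\<^sub>R y i)))) / 2 ^ n \<partial>std_gaussian)"
    by (simp add: average_cos_signs[symmetric] inner_sum_right sum_distrib_left mult_ac)
  also have "\<dots> = (\<Sum>s\<in>signs n. (\<integral>z. cos (z \<bullet> (sqrt (2 * \<kappa>) *\<^sub>R (\<Sum>i<n. s i *\<^sub>R y i))) \<partial>std_gaussian)) / 2 ^ n"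
    by (subst integral_divide_zero, subst Bochner_Integration.integral_sum)
       (auto intro!: G.integrable_const_bound[of _ 1])
  also have "\<dots> = (\<Sum>s\<in>signs n. exp (- \<kappa> * (norm (\<Sum>i<n. s i *\<^sub>R y i))\<^sup>2)) / 2 ^ n"
    using assms by (subst integral_cos_std_gaussian) (simp add: power_mult_distrib)
  finally show ?thesis by simp
qed

text \<open>The bound involves the vectors only through their lengths being at most \<open>1\<close>; this uniformity allows
  averaging over all the odd assignments at once. The minimum with \<open>2\<close> keeps the integrand below a
  constant, so that dominated convergence applies as \<open>n\<close> grows.\<close>

lemma average_laplace_signs_gaussian_bound:
  fixes y :: "nat \<Rightarrow> real ^ 'd"
  assumes "\<kappa> \<ge> 0" and y: "\<And>i. i < n \<Longrightarrow> norm (y i) \<le> 1"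
  shows "\<bar>(\<Sum>s\<in>signs n. exp (- \<kappa> * (norm ((1 / sqrt n) *\<^sub>R (\<Sum>i<n. s i *\<^sub>R y i)))\<^sup>2)) / 2 ^ n
       - (\<integral>z. exp (- \<kappa> * ((\<Sum>i<n. (z \<bullet> y i)\<^sup>2) / n)) \<partial>std_gaussian)\<bar>
    \<le> (\<integral>z. min 2 (4 * \<kappa>\<^sup>2 * norm z ^ 4 / n) \<partial>(std_gaussian :: (real ^ 'd) measure))"
proof (cases "n = 0")
  case False
  interpret G: prob_space "std_gaussian :: (real ^ 'd) measure" by (rule prob_space_std_gaussian)
  define C where "C z = (\<Prod>i<n. cos (sqrt (2 * (\<kappa> / n)) * (z \<bullet> y i)))" for z
  define E where "E z = exp (- \<kappa> * ((\<Sum>i<n. (z \<bullet> y i)\<^sup>2) / n))" for z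
  have C_le: "\<bar>C z\<bar> \<le> 1" for z unfolding C_def abs_prod by (intro prod_le_1) auto
  have E_le: "\<bar>E z\<bar> \<le> 1" for z unfolding E_def using assms(1) by (auto intro!: divide_nonneg_nonneg mult_nonneg_nonneg sum_nonneg)
  have [measurable]: "C \<in> borel_measurable borel" "E \<in> borel_measurable borel"
    unfolding C_def[abs_def] E_def[abs_def] by measurable
  have int: "integrable std_gaussian C" "integrable std_gaussian E"
    using C_le E_le by (auto intro!: G.integrable_const_bound[of _ 1])
  have "(\<Sum>s\<in>signs n. exp (- \<kappa> * (norm ((1 / sqrt n) *\<^sub>R (\<Sum>i<n. s i *\<^sub>R y i)))\<^sup>2)) / 2 ^ n
     = (\<Sum>s\<in>signs n. exp (- (\<kappa> / n) * (norm (\<Sum>i<n. s i *\<^sub>R y i))\<^sup>2)) / 2 ^ n"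
    by (simp add: power_mult_distrib power_divide field_simps)
  also have "\<dots> = (\<integral>z. C z \<partial>std_gaussian)"
    unfolding C_def using assms(1) by (intro average_laplace_signs) simp
  finally have "\<bar>(\<Sum>s\<in>signs n. exp (- \<kappa> * (norm ((1 / sqrt n) *\<^sub>R (\<Sum>i<n. s i *\<^sub>R y i)))\<^sup>2)) / 2 ^ n
       - (\<integral>z. E z \<partial>std_gaussian)\<bar> = \<bar>\<integral>z. C z - E z \<partial>std_gaussian\<bar>"
    using int by simp
  also have "\<dots> \<le> (\<integral>z. \<bar>C z - E z\<bar> \<partial>std_gaussian)" by (rule integral_abs_bound)
  also have "\<dots> \<le> (\<integral>z. min 2 (4 * \<kappa>\<^sup>2 * norm z ^ 4 / n) \<partial>(std_gaussian :: (real ^ 'd) measure))"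
  proof (rule integral_mono)
    show "integrable std_gaussian (\<lambda>z. \<bar>C z - E z\<bar>)" using int by auto
    show "integrable std_gaussian (\<lambda>z::real^'d. min 2 (4 * \<kappa>\<^sup>2 * norm z ^ 4 / n))"
      by (intro G.integrable_const_bound[of _ 2]) auto
    fix z :: "real ^ 'd"
    have E: "E z = exp (- ((\<Sum>i<n. (sqrt (2 * (\<kappa> / n)) * (z \<bullet> y i))\<^sup>2) / 2))"
      using assms(1) by (simp add: E_def power_mult_distrib sum_distrib_left sum_divide_distrib sum_negf mult_ac)
    have "\<bar>C z - E z\<bar> \<le> (\<Sum>i<n. (sqrt (2 * (\<kappa> / n)) * (z \<bullet> y i)) ^ 4)"
      unfolding C_def E by (rule prod_cos_minus_exp_bound)
    also have "\<dots> \<le> (\<Sum>i<n. 4 * \<kappa>\<^sup>2 / n\<^sup>2 * norm z ^ 4)"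
    proof (rule sum_mono)
      fix i assume "i \<in> {..<n}"
      then have "\<bar>z \<bullet> y i\<bar> \<le> norm z"
        using Cauchy_Schwarz_ineq2[of z "y i"] mult_left_mono[OF y, of i "norm z"] by simp
      then have "(z \<bullet> y i) ^ 4 \<le> norm z ^ 4"
        using power_mono[of "\<bar>z \<bullet> y i\<bar>" "norm z" 4] by (simp add: power_even_abs)
      moreover have "sqrt (2 * (\<kappa> / n)) ^ 4 = (sqrt (2 * (\<kappa> / n)) ^ 2) ^ 2"
        by (simp flip: power_mult)
      then have "sqrt (2 * (\<kappa> / n)) ^ 4 = 4 * \<kappa>\<^sup>2 / n\<^sup>2"
        using assms(1) by (simp add: power_mult_distrib power_divide)
      ultimately show "(sqrt (2 * (\<kappa> / n)) * (z \<bullet> y i)) ^ 4 \<le> 4 * \<kappa>\<^sup>2 / n\<^sup>2 * norm z ^ 4"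
        unfolding power_mult_distrib by (simp add: divide_right_mono mult_left_mono)
    qed
    also have "\<dots> = 4 * \<kappa>\<^sup>2 * norm z ^ 4 / n" using False by (simp add: power2_eq_square)
    finally show "\<bar>C z - E z\<bar> \<le> min 2 (4 * \<kappa>\<^sup>2 * norm z ^ 4 / n)"
      using C_le[of z] E_le[of z] by simp
  qed
  finally show ?thesis by (simp add: E_def)
next
  case True
  interpret G: prob_space "std_gaussian :: (real ^ 'd) measure" by (rule prob_space_std_gaussian)
  have "signs 0 = {\<lambda>_. undefined}" by (simp add: signs_def)
  with True show ?thesis using G.prob_space by simp
qed

lemma average_laplace_signs_error_tendsto_0:
  "(\<lambda>n. \<integral>z. min 2 (4 * \<kappa>\<^sup>2 * norm z ^ 4 / real n) \<partial>(std_gaussian :: (real ^ 'd) measure)) \<longlonglongrightarrow> 0"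
proof -
  interpret G: prob_space "std_gaussian :: (real ^ 'd) measure" by (rule prob_space_std_gaussian)
  have "(\<lambda>n. \<integral>z. min 2 (4 * \<kappa>\<^sup>2 * norm z ^ 4 / real n) \<partial>(std_gaussian :: (real ^ 'd) measure))
      \<longlonglongrightarrow> (\<integral>z. 0 \<partial>(std_gaussian :: (real ^ 'd) measure))"
  proof (rule integral_dominated_convergence[where w = "\<lambda>_. 2"])
    have "(\<lambda>n. min 2 (4 * \<kappa>\<^sup>2 * norm z ^ 4 / real n)) \<longlonglongrightarrow> min 2 0" for z :: "real^'d"
      by (intro tendsto_min tendsto_const lim_const_over_n)
    then show "AE z in (std_gaussian :: (real ^ 'd) measure). (\<lambda>n. min 2 (4 * \<kappa>\<^sup>2 * norm z ^ 4 / real n)) \<longlonglongrightarrow> 0"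
      by simp
  qed (auto simp: abs_le_iff)
  then show ?thesis by simp
qed

section \<open>Second moments of the spherical uniform distribution\<close>

text \<open>Rotation by a right angle in the plane of the coordinates \<open>i\<close> and \<open>j\<close>. Invariance under it gives both
  symmetries needed for second moments: it exchanges the two squared coordinates and reverses the
  sign of their product.\<close>

definition quarter_turn :: "'d \<Rightarrow> 'd \<Rightarrow> real ^ 'd \<Rightarrow> real ^ 'd" where
  "quarter_turn i j x = (\<chi> k. if k = i then x $ j else if k = j then - x $ i else x $ k)"

lemma norm_quarter_turn:
  assumes "i \<noteq> j" shows "norm (quarter_turn i j x) = norm x"
proof -
  have "(\<Sum>k\<in>UNIV. (quarter_turn i j x $ k)\<^sup>2) = (\<Sum>k\<in>UNIV. (x $ k)\<^sup>2)"
  proof -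
    have "(\<Sum>k\<in>UNIV. (quarter_turn i j x $ k)\<^sup>2)
        = (\<Sum>k\<in>UNIV - {i, j}. (quarter_turn i j x $ k)\<^sup>2) + (x $ j)\<^sup>2 + (x $ i)\<^sup>2"
      using assms by (subst sum.subset_diff[of "{i, j}"]) (auto simp: quarter_turn_def)
    also have "(\<Sum>k\<in>UNIV - {i, j}. (quarter_turn i j x $ k)\<^sup>2) = (\<Sum>k\<in>UNIV - {i, j}. (x $ k)\<^sup>2)"
      by (intro sum.cong) (auto simp: quarter_turn_def)
    also have "\<dots> + (x $ j)\<^sup>2 + (x $ i)\<^sup>2 = (\<Sum>k\<in>UNIV. (x $ k)\<^sup>2)"
      using assms by (subst (2) sum.subset_diff[of "{i, j}"]) auto
    finally show ?thesis .
  qed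
  then show ?thesis by (simp add: norm_vec_def L2_set_def)
qed

lemma linear_quarter_turn: "linear (quarter_turn i j)"
  by (intro linearI) (auto simp: vec_eq_iff quarter_turn_def)

lemma measurable_quarter_turn [measurable]: "quarter_turn i j \<in> borel_measurable borel"
  using linear_quarter_turn by (intro borel_measurable_continuous_onI linear_continuous_on) (simp add: linear_conv_bounded_linear)

lemma prod_Basis_cart: "(\<Prod>b\<in>Basis. v \<bullet> b) = (\<Prod>k\<in>UNIV. v $ k)" for v :: "real ^ 'd"
proof -
  have B: "(Basis :: (real ^ 'd) set) = (\<lambda>k. axis k 1) ` UNIV" by (auto simp: Basis_vec_def)
  have "inj (\<lambda>k. axis k (1::real) :: real ^ 'd)" by (auto simp: inj_on_def axis_eq_axis)
  then show ?thesis unfolding B by (subst prod.reindex) (auto simp: inner_axis)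
qed

text \<open>A quarter turn permutes open boxes and preserves their volume.\<close>

lemma distr_lborel_quarter_turn:
  fixes i j :: "'d::finite"
  assumes "i \<noteq> j" shows "distr lborel borel (quarter_turn i j) = lborel"
proof (rule lborel_eqI[symmetric])
  fix l u :: "real ^ 'd" assume lu: "\<And>b. b \<in> Basis \<Longrightarrow> l \<bullet> b \<le> u \<bullet> b"
  then have lu': "l $ k \<le> u $ k" for k using lu[of "axis k 1"] by (simp add: inner_axis)
  define l' where "l' = (\<chi> k. if k = j then l $ i else if k = i then - u $ j else l $ k)"
  define u' where "u' = (\<chi> k. if k = j then u $ i else if k = i then - l $ j else u $ k)"
  have vimage: "quarter_turn i j -` box l u = box l' u'"
  proof (intro set_eqI)
    fix x
    have "x \<in> quarter_turn i j -` box l u \<longleftrightarrow>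
        (\<forall>k. l $ k < quarter_turn i j x $ k \<and> quarter_turn i j x $ k < u $ k)"
      by (simp add: mem_box_cart)
    also have "\<dots> \<longleftrightarrow> (\<forall>k. l' $ k < x $ k \<and> x $ k < u' $ k)"
      (is "(\<forall>k. ?L k) \<longleftrightarrow> (\<forall>k. ?R k)")
    proof (intro iffI allI)
      fix k assume L: "\<forall>k. ?L k"
      from L[rule_format, of i] L[rule_format, of j] L[rule_format, of k] assms show "?R k"
        by (cases "k = i"; cases "k = j") (auto simp: quarter_turn_def l'_def u'_def)
    next
      fix k assume R: "\<forall>k. ?R k"
      from R[rule_format, of i] R[rule_format, of j] R[rule_format, of k] assms show "?L k"
        by (cases "k = i"; cases "k = j") (auto simp: quarter_turn_def l'_def u'_def)
    qed
    finally show "x \<in> quarter_turn i j -` box l u \<longleftrightarrow> x \<in> box l' u'" by (simp add: mem_box_cart)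
  qed
  have le': "l' \<bullet> b \<le> u' \<bullet> b" if "b \<in> Basis" for b
    using that lu' by (auto simp: Basis_vec_def inner_axis l'_def u'_def)
  have "(\<Prod>k\<in>UNIV. (u' - l') $ k) = (\<Prod>k\<in>UNIV - {i, j}. (u' - l') $ k) * (((u - l) $ i) * ((u - l) $ j))"
    using assms by (subst prod.subset_diff[of "{i, j}"]) (auto simp: l'_def u'_def)
  also have "(\<Prod>k\<in>UNIV - {i, j}. (u' - l') $ k) = (\<Prod>k\<in>UNIV - {i, j}. (u - l) $ k)"
    by (intro prod.cong) (auto simp: l'_def u'_def)
  also have "\<dots> * (((u - l) $ i) * ((u - l) $ j)) = (\<Prod>k\<in>UNIV. (u - l) $ k)"
    using assms by (subst (2) prod.subset_diff[of "{i, j}"]) auto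
  finally have vol: "(\<Prod>b\<in>Basis. (u' - l') \<bullet> b) = (\<Prod>b\<in>Basis. (u - l) \<bullet> b)"
    by (simp only: prod_Basis_cart)
  have "emeasure (distr lborel borel (quarter_turn i j)) (box l u) = emeasure lborel (box l' u')"
    by (subst emeasure_distr) (auto simp: vimage)
  also have "\<dots> = (\<Prod>b\<in>Basis. (u - l) \<bullet> b)"
    using le' by (simp add: vol)
  finally show "emeasure (distr lborel borel (quarter_turn i j)) (box l u) = (\<Prod>b\<in>Basis. (u - l) \<bullet> b)" .
qed simp

lemma sets_uniform_sphere [simp, measurable_cong]: "sets uniform_sphere = sets borel"
  and space_uniform_sphere [simp]: "space uniform_sphere = UNIV"
  by (simp_all add: uniform_sphere_def)

lemma integral_uniform_sphere_quarter_turn: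
  fixes f :: "real ^ 'd \<Rightarrow> real"
  assumes "i \<noteq> j" and [measurable]: "f \<in> borel_measurable borel"
  shows "(\<integral>z. f (quarter_turn i j z) \<partial>uniform_sphere) = (\<integral>z. f z \<partial>uniform_sphere)"
proof -
  let ?B = "ball (0 :: real ^ 'd) 1"
  have inv: "distr (uniform_measure lborel ?B) borel (quarter_turn i j) = uniform_measure lborel ?B"
  proof (rule measure_eqI)
    fix A assume "A \<in> sets (distr (uniform_measure lborel ?B) borel (quarter_turn i j))"
    then have [measurable]: "A \<in> sets borel" by simp
    have "?B \<inter> quarter_turn i j -` A = quarter_turn i j -` (?B \<inter> A)"
      using norm_quarter_turn[OF assms(1)] by auto
    then have "emeasure lborel (?B \<inter> quarter_turn i j -` A)
        = emeasure (distr lborel borel (quarter_turn i j)) (?B \<inter> A)"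
      by (simp add: emeasure_distr)
    then show "emeasure (distr (uniform_measure lborel ?B) borel (quarter_turn i j)) A
        = emeasure (uniform_measure lborel ?B) A"
      by (simp add: emeasure_distr measurable_sets_borel[OF measurable_quarter_turn]
            distr_lborel_quarter_turn[OF assms(1)])
  qed simp
  have sgn_turn: "quarter_turn i j (sgn x) = sgn (quarter_turn i j x)" for x
    by (simp add: sgn_div_norm norm_quarter_turn[OF assms(1)] linear_cmul[OF linear_quarter_turn])
  have "(\<integral>z. f (quarter_turn i j z) \<partial>uniform_sphere)
      = (\<integral>x. f (sgn (quarter_turn i j x)) \<partial>uniform_measure lborel ?B)"
    unfolding uniform_sphere_def by (subst integral_distr) (auto simp: sgn_turn)
  also have "\<dots> = (\<integral>x. f (sgn x) \<partial>distr (uniform_measure lborel ?B) borel (quarter_turn i j))"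
    by (subst integral_distr) auto
  also have "\<dots> = (\<integral>x. f (sgn x) \<partial>uniform_measure lborel ?B)"
    by (simp only: inv)
  also have "\<dots> = (\<integral>z. f z \<partial>uniform_sphere)"
    unfolding uniform_sphere_def by (subst integral_distr) auto
  finally show ?thesis .
qed

text \<open>By invariance under quarter turns the second-moment matrix is a multiple of the identity, and its trace
  is \<open>1\<close> since the points have norm \<open>1\<close>.\<close>

lemma second_moment_uniform_sphere:
  "(\<integral>z. (t \<bullet> z)\<^sup>2 \<partial>uniform_sphere) = (norm t)\<^sup>2 / CARD('d)" for t :: "real ^ 'd"
proof -
  interpret U: prob_space "uniform_sphere :: (real ^ 'd) measure" by (rule prob_space_uniform_sphere)
  have int: "integrable uniform_sphere (\<lambda>z :: real ^ 'd. z $ i * z $ j)" for i j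
  proof (rule U.integrable_const_bound[of _ 1])
    show "AE z :: real ^ 'd in uniform_sphere. norm (z $ i * z $ j) \<le> 1"
      using AE_uniform_sphere_norm
    proof eventually_elim
      case (elim z)
      then show ?case using component_le_norm_cart[of z i] component_le_norm_cart[of z j]
        by (simp add: abs_mult mult_le_one)
    qed
  qed simp
  let ?m = "\<lambda>i j. integral\<^sup>L uniform_sphere (\<lambda>z :: real ^ 'd. z $ i * z $ j)"
  have off: "?m i j = 0" if "i \<noteq> j" for i j
    using integral_uniform_sphere_quarter_turn[OF that, of "\<lambda>z. z $ i * z $ j"] that
    by (simp add: quarter_turn_def mult.commute)
  have same: "?m i i = ?m j j" for i j
    using integral_uniform_sphere_quarter_turn[of i j "\<lambda>z. z $ i * z $ i"]
    by (cases "i = j") (simp_all add: quarter_turn_def)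
  have norm_sq: "(\<Sum>i\<in>UNIV. z $ i * z $ i) = (norm z)\<^sup>2" for z :: "real ^ 'd"
    by (simp add: norm_vec_def L2_set_def sum_nonneg power2_eq_square)
  have "(\<Sum>i\<in>UNIV. ?m i i) = (\<integral>z. (norm z)\<^sup>2 \<partial>(uniform_sphere :: (real ^ 'd) measure))"
    using int by (simp flip: norm_sq)
  also have "\<dots> = (\<integral>z. 1 \<partial>(uniform_sphere :: (real ^ 'd) measure))"
    using AE_uniform_sphere_norm by (intro integral_cong_AE) auto
  finally have total: "(\<Sum>i\<in>UNIV. ?m i i) = 1" using U.prob_space by simp
  have diag: "?m i i = 1 / CARD('d)" for i
  proof -
    have "(\<Sum>j\<in>UNIV. ?m j j) = (\<Sum>j\<in>(UNIV :: 'd set). ?m i i)" by (intro sum.cong refl same)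
    with total show ?thesis by (simp add: field_simps)
  qed
  have "(\<integral>z. (t \<bullet> z)\<^sup>2 \<partial>uniform_sphere) = (\<integral>z. (\<Sum>i\<in>UNIV. \<Sum>j\<in>UNIV. (t $ i * t $ j) * (z $ i * z $ j)) \<partial>uniform_sphere)"
    by (simp add: inner_vec_def power2_eq_square sum_product mult_ac)
  also have "\<dots> = (\<Sum>i\<in>UNIV. \<Sum>j\<in>UNIV. (t $ i * t $ j) * ?m i j)"
    using int by simp
  also have "\<dots> = (\<Sum>i\<in>UNIV. \<Sum>j\<in>UNIV. if j = i then t $ i * t $ i / CARD('d) else 0)"
    by (intro sum.cong refl) (auto simp: off diag)
  also have "\<dots> = (norm t)\<^sup>2 / CARD('d)" by (simp flip: norm_sq sum_divide_distrib)
  finally show ?thesis .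
qed

lemma integral_spherical_uniform:
  fixes f :: "'a::euclidean_space \<Rightarrow> real"
  assumes [measurable]: "f \<in> borel_measurable borel" and bound: "\<And>x. norm x \<le> 1 \<Longrightarrow> \<bar>f x\<bar> \<le> B"
  shows "(\<integral>x. f x \<partial>spherical_uniform) = (\<integral>r. (\<integral>z. f (r *\<^sub>R z) \<partial>uniform_sphere) \<partial>uniform_measure lborel {0..1::real})"
proof -
  interpret U: prob_space "uniform_sphere :: ('a) measure" by (rule prob_space_uniform_sphere)
  interpret R: prob_space "uniform_measure lborel {0..1::real}" by (intro prob_space_uniform_measure) auto
  have [measurable]: "(\<lambda>p. f (fst p *\<^sub>R snd p)) \<in> borel_measurable (borel \<Otimes>\<^sub>M borel)" by measurable
  interpret P: pair_prob_space "uniform_measure lborel {0..1::real}" "uniform_sphere :: ('a) measure" ..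
  have "(\<integral>x. f x \<partial>spherical_uniform)
      = (\<integral>p. f (case p of (r, z) \<Rightarrow> r *\<^sub>R z) \<partial>(uniform_measure lborel {0..1::real} \<Otimes>\<^sub>M uniform_sphere))"
    unfolding spherical_uniform_def by (subst integral_distr) (auto simp: split_beta')
  also have "\<dots> = (\<integral>p. (case p of (r, z) \<Rightarrow> f (r *\<^sub>R z)) \<partial>(uniform_measure lborel {0..1::real} \<Otimes>\<^sub>M uniform_sphere))"
    by (intro Bochner_Integration.integral_cong) auto
  also have "\<dots> = (\<integral>r. (\<integral>z. f (r *\<^sub>R z) \<partial>uniform_sphere) \<partial>uniform_measure lborel {0..1::real})"
  proof (rule P.integral_fst[symmetric])
    show "integrable (uniform_measure lborel {0..1::real} \<Otimes>\<^sub>M uniform_sphere) (\<lambda>(r, z). f (r *\<^sub>R z))"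
    proof (rule P.integrable_const_bound[of _ B])
      have "AE r in uniform_measure lborel {0..1::real}. AE z in (uniform_sphere :: ('a) measure). norm (f (r *\<^sub>R z)) \<le> B"
        using AE_uniform_sphere_norm
        by (intro AE_uniform_measureI AE_I2) (auto intro!: bound elim!: eventually_mono)
      then show "AE p in uniform_measure lborel {0..1::real} \<Otimes>\<^sub>M (uniform_sphere :: ('a) measure).
          norm (case p of (r, z) \<Rightarrow> f (r *\<^sub>R z)) \<le> B"
        unfolding split_beta' by (intro P.AE_pair_measure, measurable)
    qed (simp add: split_beta')
  qed
  finally show ?thesis .
qed

lemma spherical_uniform_pair:
  shows "pair_prob_space (uniform_measure lborel {0..1::real}) (uniform_sphere :: 'a::euclidean_space measure)"
proof -
  interpret R: prob_space "uniform_measure lborel {0..1::real}" by (intro prob_space_uniform_measure) auto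
  interpret U: prob_space "uniform_sphere :: 'a measure" by (rule prob_space_uniform_sphere)
  show ?thesis ..
qed

lemma prob_space_spherical_uniform: "prob_space (spherical_uniform :: 'a::euclidean_space measure)"
proof -
  interpret P: pair_prob_space "uniform_measure lborel {0..1::real}" "uniform_sphere :: 'a measure"
    by (rule spherical_uniform_pair)
  show ?thesis unfolding spherical_uniform_def
    by (rule P.prob_space_distr) (simp add: split_beta')
qed

lemma sets_spherical_uniform [simp, measurable_cong]: "sets spherical_uniform = sets borel"
  by (simp add: spherical_uniform_def)

lemma AE_spherical_uniform_nonzero: "AE x in (spherical_uniform :: 'a::euclidean_space measure). x \<noteq> 0"
proof -
  interpret P: pair_prob_space "uniform_measure lborel {0..1::real}" "uniform_sphere :: 'a measure"
    by (rule spherical_uniform_pair)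
  have "AE r in uniform_measure lborel {0..1::real}. AE z in (uniform_sphere :: 'a measure). r *\<^sub>R z \<noteq> 0"
  proof (rule AE_uniform_measureI)
    have "AE z in (uniform_sphere :: 'a measure). r *\<^sub>R z \<noteq> 0" if "r \<noteq> 0" for r :: real
      using AE_uniform_sphere_norm that by (auto elim!: eventually_mono)
    then show "AE r in lborel. r \<in> {0..1::real} \<longrightarrow> (AE z in (uniform_sphere :: 'a measure). r *\<^sub>R z \<noteq> 0)"
      using AE_lborel_singleton[of "0::real"] by (auto elim!: eventually_mono)
  qed simp
  then have "AE p in uniform_measure lborel {0..1::real} \<Otimes>\<^sub>M (uniform_sphere :: 'a measure). fst p *\<^sub>R snd p \<noteq> 0"
    by (intro P.AE_pair_measure, measurable)
  then show ?thesis unfolding spherical_uniform_def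
    by (subst AE_distr_iff) (auto simp: split_beta')
qed

lemma integral_square_uniform_01: "(\<integral>r. r\<^sup>2 * c \<partial>uniform_measure lborel {0..1::real}) = c / 3"
proof -
  have "uniform_measure lborel {0..1::real} = density lborel (\<lambda>x. ennreal (indicator {0..1} x))"
    unfolding uniform_measure_def by (intro density_cong) (auto split: split_indicator)
  then have "(\<integral>r. r\<^sup>2 \<partial>uniform_measure lborel {0..1::real}) = (\<integral>r. r ^ 2 * indicator {0..1} r \<partial>lborel)"
    by (simp add: integral_density mult.commute)
  also have "\<dots> = 1 / 3" by (subst integral_power) auto
  finally show ?thesis by simp
qed

text \<open>The identity for \<open>h\<close> is required on the unit ball only, so that \<open>h\<close> can be a bounded truncation of the
  quadratic form, as a test function for weak convergence must be.\<close>

lemma second_moment_spherical_uniform: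
  fixes h :: "real ^ 'd \<Rightarrow> real"
  assumes [measurable]: "h \<in> borel_measurable borel"
    and "\<And>x. norm x \<le> 1 \<Longrightarrow> h x = (t \<bullet> x)\<^sup>2"
  shows "(\<integral>x. h x \<partial>spherical_uniform) = (norm t)\<^sup>2 / (3 * CARD('d))"
proof -
  have le: "\<bar>h x\<bar> \<le> (norm t)\<^sup>2" if "norm x \<le> 1" for x
  proof -
    have "\<bar>t \<bullet> x\<bar> \<le> norm t" using Cauchy_Schwarz_ineq2[of t x] mult_left_mono[OF that, of "norm t"] by simp
    then show ?thesis using assms(2)[OF that] power_mono[of "\<bar>t \<bullet> x\<bar>" "norm t" 2] by simp
  qed
  have "(\<integral>x. h x \<partial>spherical_uniform)
      = (\<integral>r. (\<integral>z. h (r *\<^sub>R z) \<partial>uniform_sphere) \<partial>uniform_measure lborel {0..1::real})"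
    using le by (rule integral_spherical_uniform[OF assms(1)])
  also have "\<dots> = (\<integral>r. r\<^sup>2 * ((norm t)\<^sup>2 / CARD('d)) \<partial>uniform_measure lborel {0..1::real})"
  proof (rule integral_cong_AE)
    have "(\<integral>z. h (r *\<^sub>R z) \<partial>uniform_sphere) = r\<^sup>2 * ((norm t)\<^sup>2 / CARD('d))" if "r \<in> {0..1}" for r
    proof -
      have "(\<integral>z. h (r *\<^sub>R z) \<partial>uniform_sphere) = (\<integral>z. r\<^sup>2 * (t \<bullet> z)\<^sup>2 \<partial>uniform_sphere)"
        using AE_uniform_sphere_norm that assms(2)
        by (intro integral_cong_AE) (auto elim!: eventually_mono simp: power_mult_distrib)
      then show ?thesis by (simp add: second_moment_uniform_sphere)
    qed
    then show "AE r in uniform_measure lborel {0..1}. (\<integral>z. h (r *\<^sub>R z) \<partial>uniform_sphere) = r\<^sup>2 * ((norm t)\<^sup>2 / CARD('d))"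
      by (intro AE_uniform_measureI) auto
    interpret U: prob_space "uniform_sphere :: (real ^ 'd) measure" by (rule prob_space_uniform_sphere)
    show "(\<lambda>r. \<integral>z. h (r *\<^sub>R z) \<partial>uniform_sphere) \<in> borel_measurable (uniform_measure lborel {0..1})"
      by measurable
  qed auto
  also have "\<dots> = (norm t)\<^sup>2 / (3 * CARD('d))" by (subst integral_square_uniform_01) simp
  finally show ?thesis .
qed

lemma sign_second_moment_spherical_uniform:
  fixes t :: "real ^ 'd"
  shows "(\<integral>x. (t \<bullet> sgn x)\<^sup>2 \<partial>spherical_uniform) = (norm t)\<^sup>2 / CARD('d)"
proof -
  interpret R: prob_space "uniform_measure lborel {0..1::real}" by (intro prob_space_uniform_measure) auto
  interpret U: prob_space "uniform_sphere :: (real ^ 'd) measure" by (rule prob_space_uniform_sphere)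
  have le: "\<bar>(t \<bullet> sgn x)\<^sup>2\<bar> \<le> (norm t)\<^sup>2" for x
  proof -
    have "\<bar>t \<bullet> sgn x\<bar> \<le> norm t" using Cauchy_Schwarz_ineq2[of t "sgn x"] by (auto simp: norm_sgn split: if_splits)
    then show ?thesis using power_mono[of "\<bar>t \<bullet> sgn x\<bar>" "norm t" 2] by simp
  qed
  have "(\<integral>x. (t \<bullet> sgn x)\<^sup>2 \<partial>spherical_uniform)
      = (\<integral>r. (\<integral>z. (t \<bullet> sgn (r *\<^sub>R z))\<^sup>2 \<partial>uniform_sphere) \<partial>uniform_measure lborel {0..1::real})"
    using le by (intro integral_spherical_uniform) auto
  also have "\<dots> = (\<integral>r. (norm t)\<^sup>2 / CARD('d) \<partial>uniform_measure lborel {0..1::real})"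
  proof (rule integral_cong_AE)
    have "(\<integral>z. (t \<bullet> sgn (r *\<^sub>R z))\<^sup>2 \<partial>uniform_sphere) = (norm t)\<^sup>2 / CARD('d)" if "r > 0" for r
    proof -
      have "(\<integral>z. (t \<bullet> sgn (r *\<^sub>R z))\<^sup>2 \<partial>uniform_sphere) = (\<integral>z. (t \<bullet> z)\<^sup>2 \<partial>uniform_sphere)"
        using AE_uniform_sphere_norm that
        by (intro integral_cong_AE) (auto elim!: eventually_mono simp: sgn_scaleR sgn_div_norm)
      then show ?thesis by (simp add: second_moment_uniform_sphere)
    qed
    then show "AE r in uniform_measure lborel {0..1}. (\<integral>z. (t \<bullet> sgn (r *\<^sub>R z))\<^sup>2 \<partial>uniform_sphere) = (norm t)\<^sup>2 / CARD('d)"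
      using AE_lborel_singleton[of "0::real"]
      by (intro AE_uniform_measureI) (auto elim!: eventually_mono)
    show "(\<lambda>r. \<integral>z. (t \<bullet> sgn (r *\<^sub>R z))\<^sup>2 \<partial>uniform_sphere) \<in> borel_measurable (uniform_measure lborel {0..1})"
      by measurable
  qed auto
  also have "\<dots> = (norm t)\<^sup>2 / CARD('d)" using R.prob_space by simp
  finally show ?thesis .
qed

section \<open>Second moments of the grids\<close>

text \<open>A single discontinuity is harmless if the limit law does not charge it. The cutoff
  \<open>min 1 (m * norm x)\<close> removes it, and the mass that the cutoff loses under \<open>\<mu> n\<close> is itself the integral
  of a continuous function, hence asymptotically the one lost under \<open>\<nu>\<close>, which is small for large \<open>m\<close>.
  This is what the signs need, because \<open>sgn\<close> jumps at the origin.\<close>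

lemma weakly_converges_discontinuous_at_0:
  fixes \<mu> :: "nat \<Rightarrow> 'a::euclidean_space measure" and h :: "'a \<Rightarrow> real"
  assumes weak: "weakly_converges \<mu> \<nu>"
    and \<mu>: "\<And>n. n \<ge> 1 \<Longrightarrow> prob_space (\<mu> n)" "\<And>n. n \<ge> 1 \<Longrightarrow> sets (\<mu> n) = sets borel"
    and \<nu>: "prob_space \<nu>" "sets \<nu> = sets borel" "AE x in \<nu>. x \<noteq> 0"
    and h [measurable]: "h \<in> borel_measurable borel" and cont: "continuous_on (- {0}) h" and bound: "\<And>x. \<bar>h x\<bar> \<le> B"
  shows "(\<lambda>n. \<integral>x. h x \<partial>\<mu> n) \<longlonglongrightarrow> (\<integral>x. h x \<partial>\<nu>)"
proof (rule LIMSEQ_I)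
  interpret N: prob_space \<nu> by fact
  note [measurable_cong] = \<nu>(2)
  have B: "0 \<le> B" using bound[of 0] by simp
  define w :: "nat \<Rightarrow> 'a \<Rightarrow> real" where "w m x = min 1 (real m * norm x)" for m x
  have w: "0 \<le> w m x" "w m x \<le> 1" for m x by (simp_all add: w_def)
  have w_cont: "continuous_on UNIV (w m)" for m unfolding w_def[abs_def] by (intro continuous_intros)
  have [measurable]: "w m \<in> borel_measurable borel" for m by (intro borel_measurable_continuous_onI w_cont)
  have wh_le: "\<bar>w m x * h x\<bar> \<le> B" for m x
    using mult_mono[of "w m x" 1 "\<bar>h x\<bar>" B] w[of m x] bound[of x] B by (simp add: abs_mult)
  have wh_cont: "continuous_on UNIV (\<lambda>x. w m x * h x)" for m
  proof (rule continuous_at_imp_continuous_on, rule ballI)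
    fix x :: "'a"
    show "isCont (\<lambda>x. w m x * h x) x"
    proof (cases "x = 0")
      case False
      have "continuous_on (- {0}) (\<lambda>x. w m x * h x)"
        by (intro continuous_on_mult cont continuous_on_subset[OF w_cont]) auto
      then show ?thesis using False by (auto simp: continuous_on_eq_continuous_at open_Compl)
    next
      case True
      have "((\<lambda>x. w m x * h x) \<longlongrightarrow> 0) (at 0)"
      proof (rule Lim_null_comparison)
        have "norm (w m x * h x) \<le> w m x * B" for x
          using w bound by (simp add: abs_mult mult_left_mono)
        then show "\<forall>\<^sub>F x in at 0. norm (w m x * h x) \<le> w m x * B" by simp
        have "((\<lambda>x. w m x * B) \<longlongrightarrow> w m 0 * B) (at 0)"
          using w_cont[of m] by (intro tendsto_intros) (auto simp: continuous_on_eq_continuous_at isCont_def)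
        then show "((\<lambda>x. w m x * B) \<longlongrightarrow> 0) (at 0)" by (simp add: w_def)
      qed
      then show ?thesis using True by (simp add: isCont_def w_def)
    qed
  qed
  have conv: "(\<lambda>n. \<integral>x. w m x * h x \<partial>\<mu> n) \<longlonglongrightarrow> (\<integral>x. w m x * h x \<partial>\<nu>)" for m
  proof -
    have "bounded (range (\<lambda>x. w m x * h x))"
      unfolding bounded_iff using wh_le by (intro exI[of _ B]) auto
    then show ?thesis using weak wh_cont unfolding weakly_converges_def by blast
  qed
  have conv': "(\<lambda>n. \<integral>x. 1 - w m x \<partial>\<mu> n) \<longlonglongrightarrow> (\<integral>x. 1 - w m x \<partial>\<nu>)" for m
  proof -
    have "continuous_on UNIV (\<lambda>x. 1 - w m x)" by (intro continuous_intros w_cont)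
    moreover have "bounded (range (\<lambda>x. 1 - w m x))"
      unfolding bounded_iff using w by (intro exI[of _ 1]) auto
    ultimately show ?thesis using weak unfolding weakly_converges_def by blast
  qed
  have err: "\<bar>(\<integral>x. h x \<partial>\<kappa>) - (\<integral>x. w m x * h x \<partial>\<kappa>)\<bar> \<le> B * (\<integral>x. 1 - w m x \<partial>\<kappa>)"
    if "prob_space \<kappa>" and [measurable_cong]: "sets \<kappa> = sets borel" for \<kappa> m
  proof -
    interpret K: prob_space \<kappa> by fact
    have "integrable \<kappa> h" "integrable \<kappa> (\<lambda>x. w m x * h x)"
      using bound wh_le by (auto intro!: K.integrable_const_bound[of _ B])
    moreover have "integrable \<kappa> (w m)" using w by (auto intro!: K.integrable_const_bound[of _ 1])
    ultimately have int: "integrable \<kappa> h" "integrable \<kappa> (\<lambda>x. w m x * h x)" "integrable \<kappa> (w m)" .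
    then have "\<bar>(\<integral>x. h x \<partial>\<kappa>) - (\<integral>x. w m x * h x \<partial>\<kappa>)\<bar> = \<bar>\<integral>x. h x - w m x * h x \<partial>\<kappa>\<bar>" by simp
    also have "\<dots> \<le> (\<integral>x. \<bar>h x - w m x * h x\<bar> \<partial>\<kappa>)" by (rule integral_abs_bound)
    also have "\<dots> \<le> (\<integral>x. B * (1 - w m x) \<partial>\<kappa>)"
    proof (rule integral_mono)
      fix x
      have "\<bar>h x - w m x * h x\<bar> = (1 - w m x) * \<bar>h x\<bar>"
        using w[of m x] by (simp add: abs_mult flip: left_diff_distrib[of 1 _ "h x", simplified])
      then show "\<bar>h x - w m x * h x\<bar> \<le> B * (1 - w m x)"
        using mult_right_mono[OF bound[of x], of "1 - w m x"] w[of m x] by (simp add: mult.commute)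
    qed (use int in auto)
    finally show ?thesis using int by simp
  qed
  have "(\<lambda>m. \<integral>x. 1 - w m x \<partial>\<nu>) \<longlonglongrightarrow> (\<integral>x. 0 \<partial>\<nu>)"
  proof (rule integral_dominated_convergence[where w = "\<lambda>_. 1"])
    show "AE x in \<nu>. (\<lambda>m. 1 - w m x) \<longlonglongrightarrow> 0"
      using \<nu>(3)
    proof eventually_elim
      case (elim x)
      have "\<forall>\<^sub>F m in sequentially. 1 / norm x < real m"
        by (rule filterlim_at_top_dense[THEN iffD1, rule_format, OF filterlim_real_sequentially])
      then have "\<forall>\<^sub>F m in sequentially. 1 - w m x = 0"
      proof (rule eventually_mono)
        fix m assume "1 / norm x < real m"
        then show "1 - w m x = 0" using elim by (simp add: w_def field_simps)
      qed
      then show ?case by (rule tendsto_eventually)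
    qed
    show "AE x in \<nu>. norm (1 - w m x) \<le> 1" for m using w by auto
  qed auto
  then have tail: "(\<lambda>m. B * (\<integral>x. 1 - w m x \<partial>\<nu>)) \<longlonglongrightarrow> 0" by (auto intro: tendsto_eq_intros)
  fix e :: real assume e: "0 < e"
  obtain m where m: "B * (\<integral>x. 1 - w m x \<partial>\<nu>) < e / 5"
    using order_tendstoD(2)[OF tail, of "e / 5"] e by (auto simp: eventually_sequentially)
  have "(\<lambda>n. B * (\<integral>x. 1 - w m x \<partial>\<mu> n)) \<longlonglongrightarrow> B * (\<integral>x. 1 - w m x \<partial>\<nu>)"
    by (intro tendsto_intros conv')
  from order_tendstoD(2)[OF this m]
  have "\<forall>\<^sub>F n in sequentially. B * (\<integral>x. 1 - w m x \<partial>\<mu> n) < e / 5" .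
  moreover have "\<forall>\<^sub>F n in sequentially. \<bar>(\<integral>x. w m x * h x \<partial>\<mu> n) - (\<integral>x. w m x * h x \<partial>\<nu>)\<bar> < e / 5"
    using tendstoD[OF conv[of m], of "e / 5"] e by (simp add: dist_real_def)
  moreover have "\<forall>\<^sub>F n::nat in sequentially. n \<ge> 1" by (rule eventually_ge_at_top)
  ultimately have "\<forall>\<^sub>F n in sequentially. \<bar>(\<integral>x. h x \<partial>\<mu> n) - (\<integral>x. h x \<partial>\<nu>)\<bar> < e"
  proof eventually_elim
    case (elim n)
    show ?case using err[OF \<mu>(1)[of n] \<mu>(2)[of n], of m] err[OF \<nu>(1,2), of m] elim m e by linarith
  qed
  then show "\<exists>n0. \<forall>n\<ge>n0. norm ((\<integral>x. h x \<partial>\<mu> n) - (\<integral>x. h x \<partial>\<nu>)) < e"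
    by (simp add: eventually_sequentially)
qed

lemma grid_not_empty: "is_grid N G \<Longrightarrow> N > 0 \<Longrightarrow> G \<noteq> {#}"
  by (auto simp: is_grid_def)

lemma prob_space_grid_distribution: "prob_space (grid_distribution G)"
  unfolding grid_distribution_def by (rule measure_pmf.prob_space_distr) simp

lemma sets_grid_distribution [simp, measurable_cong]: "sets (grid_distribution G) = sets borel"
  by (simp add: grid_distribution_def)

lemma sum_count_mult:
  fixes f :: "'a \<Rightarrow> real"
  assumes "finite A" "set_mset G \<subseteq> A"
  shows "(\<Sum>g\<in>#G. f g) = (\<Sum>g\<in>A. real (count G g) * f g)"
  using assms(2)
proof (induction G)
  case (add x G)
  have "(\<Sum>g\<in>A. real (count (add_mset x G) g) * f g)
      = (\<Sum>g\<in>A. real (count G g) * f g + (if g = x then f x else 0))"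
    by (intro sum.cong) (auto simp: algebra_simps)
  then show ?case using add assms(1) by (simp add: sum.distrib)
qed simp

lemma integral_grid_distribution:
  fixes f :: "'a::euclidean_space \<Rightarrow> real"
  assumes "is_grid N G" "N > 0" and [measurable]: "f \<in> borel_measurable borel"
  shows "(\<integral>x. f x \<partial>grid_distribution G) = (\<Sum>g\<in>#G. f g) / N"
proof -
  note ne = grid_not_empty[OF assms(1,2)]
  have "(\<integral>x. f x \<partial>grid_distribution G) = (\<integral>x. f x \<partial>measure_pmf (pmf_of_multiset G))"
    unfolding grid_distribution_def by (subst integral_distr) auto
  also have "\<dots> = (\<Sum>g\<in>set_mset G. f g * pmf (pmf_of_multiset G) g)"
    using ne by (intro integral_measure_pmf_real) (auto simp: set_pmf_of_multiset)
  also have "\<dots> = (\<Sum>g\<in>set_mset G. real (count G g) * f g) / N"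
    using ne assms(1) by (simp add: is_grid_def sum_divide_distrib mult.commute)
  also have "(\<Sum>g\<in>set_mset G. real (count G g) * f g) = (\<Sum>g\<in>#G. f g)"
    by (rule sum_count_mult[symmetric]) auto
  finally show ?thesis .
qed

section \<open>Optimal assignments of symmetrized samples\<close>

text \<open>The pairs \<open>p i, q i\<close> are the edges of a multigraph in which every vertex has even degree. Such a graph has
  an orientation, with heads \<open>h i\<close> and tails \<open>k i\<close>, in which every vertex is as often a head as a tail.
  By induction on the number of edges: a loop can be deleted, and two edges that meet at a vertex \<open>v\<close> can
  be replaced by one edge between their other ends, whose orientation is then inherited by the
  path through \<open>v\<close>.\<close>

lemma balanced_orientation:
  fixes p q :: "'i \<Rightarrow> 'v"
  assumes "finite I"
    and "\<And>v. even (count (image_mset p (mset_set I) + image_mset q (mset_set I)) v)"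
  obtains h k where "\<And>i. i \<in> I \<Longrightarrow> (h i = p i \<and> k i = q i) \<or> (h i = q i \<and> k i = p i)"
    and "image_mset h (mset_set I) = image_mset k (mset_set I)"
proof -
  have "\<exists>h k. (\<forall>i\<in>I. (h i = p i \<and> k i = q i) \<or> (h i = q i \<and> k i = p i)) \<and>
      image_mset h (mset_set I) = image_mset k (mset_set I)"
    using assms
  proof (induction "card I" arbitrary: I p q rule: less_induct)
    case less
    show ?case
    proof (cases "I = {}")
      case False
      then obtain i where i: "i \<in> I" by blast
      define I' where "I' = I - {i}"
      have I': "I = insert i I'" "i \<notin> I'" "finite I'" "card I' < card I"
        using i less.prems(1) card_Diff1_less[OF less.prems(1) i] unfolding I'_def by auto
      have M: "image_mset f (mset_set I) = add_mset (f i) (image_mset f (mset_set I'))" for f :: "'i \<Rightarrow> 'v"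
        using I' by simp
      show ?thesis
      proof (cases "p i = q i")
        case True
        have "even (count (image_mset p (mset_set I') + image_mset q (mset_set I')) v)" for v
          using less.prems(2)[of v] True unfolding M by (auto split: if_splits)
        from less.hyps[of I' p q, OF I'(4,3) this] obtain h k where
          hk: "\<forall>i\<in>I'. (h i = p i \<and> k i = q i) \<or> (h i = q i \<and> k i = p i)"
            "image_mset h (mset_set I') = image_mset k (mset_set I')" by auto
        define h' where "h' = h(i := p i)"
        define k' where "k' = k(i := q i)"
        have "image_mset h' (mset_set I') = image_mset h (mset_set I')"
             "image_mset k' (mset_set I') = image_mset k (mset_set I')"
          using I' by (auto intro!: image_mset_cong simp: h'_def k'_def)
        then have "image_mset h' (mset_set I) = image_mset k' (mset_set I)"
          using True hk(2) unfolding M by (simp add: h'_def k'_def)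
        moreover have "\<forall>i\<in>I. (h' i = p i \<and> k' i = q i) \<or> (h' i = q i \<and> k' i = p i)"
          using hk(1) I' by (auto simp: h'_def k'_def)
        ultimately show ?thesis by blast
      next
        case False
        define v where "v = q i"
        have "\<exists>j\<in>I'. p j = v \<or> q j = v"
        proof (rule ccontr)
          assume *: "\<not> ?thesis"
          have "count (image_mset p (mset_set I')) v = 0" "count (image_mset q (mset_set I')) v = 0"
            using * I'(3) by (auto simp: count_eq_zero_iff)
          then show False using less.prems(2)[of v] False unfolding M by (simp add: v_def)
        qed
        then obtain j where j: "j \<in> I'" "p j = v \<or> q j = v" by blast
        define J where "J = I' - {j}"
        have J: "I' = insert j J" "j \<notin> J" "finite J" "i \<notin> J" "i \<noteq> j"
          using j I' by (auto simp: J_def)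
        have N: "image_mset f (mset_set I') = add_mset (f j) (image_mset f (mset_set J))" for f :: "'i \<Rightarrow> 'v"
          using J by simp
        \<comment> \<open>edges \<open>i\<close> and \<open>j\<close> meet in \<open>v\<close>; they are replaced by one edge \<open>j\<close> from \<open>p i\<close> to \<open>w\<close>\<close>
        define w where "w = (if p j = v then q j else p j)"
        have pq_j: "(p j = v \<and> q j = w) \<or> (q j = v \<and> p j = w)" using j by (auto simp: w_def)
        define p' where "p' = p(j := p i)"
        define q' where "q' = q(j := w)"
        have pqJ: "image_mset p' (mset_set J) = image_mset p (mset_set J)"
            "image_mset q' (mset_set J) = image_mset q (mset_set J)"
          using J by (auto intro!: image_mset_cong simp: p'_def q'_def)
        have "count (image_mset p (mset_set I) + image_mset q (mset_set I)) u
            = count (image_mset p' (mset_set I') + image_mset q' (mset_set I')) u + (if u = v then 2 else 0)" for u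
          unfolding M N using pqJ pq_j by (auto simp: p'_def q'_def v_def)
        then have "even (count (image_mset p' (mset_set I') + image_mset q' (mset_set I')) u)" for u
          using less.prems(2)[of u] by (auto split: if_splits)
        from less.hyps[of I' p' q', OF I'(4,3) this] obtain h k where
          hk: "\<forall>i\<in>I'. (h i = p' i \<and> k i = q' i) \<or> (h i = q' i \<and> k i = p' i)"
            "image_mset h (mset_set I') = image_mset k (mset_set I')" by auto
        have swap: "\<exists>h k. (\<forall>i\<in>I. (h i = p i \<and> k i = q i) \<or> (h i = q i \<and> k i = p i)) \<and>
            image_mset h (mset_set I) = image_mset k (mset_set I)"
          if hk: "\<forall>i\<in>I'. (h i = p' i \<and> k i = q' i) \<or> (h i = q' i \<and> k i = p' i)"
            "image_mset h (mset_set I') = image_mset k (mset_set I')"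
            and hkj: "h j = p' j" "k j = q' j" for h k
        proof -
          define h' where "h' = h(i := p i, j := v)"
          define k' where "k' = k(i := v, j := w)"
          have "image_mset h' (mset_set J) = image_mset h (mset_set J)"
              "image_mset k' (mset_set J) = image_mset k (mset_set J)"
            using J by (auto intro!: image_mset_cong simp: h'_def k'_def)
          then have "image_mset h' (mset_set I) = image_mset k' (mset_set I)"
            using hk(2) hkj J(5) unfolding M N by (auto simp: h'_def k'_def p'_def q'_def)
          moreover have "\<forall>l\<in>I. (h' l = p l \<and> k' l = q l) \<or> (h' l = q l \<and> k' l = p l)"
          proof
            fix l assume l: "l \<in> I"
            consider "l = i" | "l = j" | "l \<in> J" using l I' J by auto
            then show "(h' l = p l \<and> k' l = q l) \<or> (h' l = q l \<and> k' l = p l)"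
            proof cases
              case 1 then show ?thesis using J(5) by (simp add: h'_def k'_def v_def)
            next
              case 2 then show ?thesis using pq_j by (auto simp: h'_def k'_def)
            next
              case 3
              then have "l \<in> I'" "l \<noteq> i" "l \<noteq> j" using J by auto
              then show ?thesis using hk(1) by (auto simp: h'_def k'_def p'_def q'_def)
            qed
          qed
          ultimately show ?thesis by blast
        qed
        from hk(1) j(1) have "(h j = p' j \<and> k j = q' j) \<or> (h j = q' j \<and> k j = p' j)" by blast
        then show ?thesis
        proof
          assume "h j = p' j \<and> k j = q' j"
          then show ?thesis using swap[OF hk] by blast
        next
          assume "h j = q' j \<and> k j = p' j"
          moreover have "\<forall>i\<in>I'. (k i = p' i \<and> h i = q' i) \<or> (k i = q' i \<and> h i = p' i)" using hk(1) by blast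
          ultimately show ?thesis using swap[OF _ hk(2)[symmetric]] by blast
        qed
      qed
    qed simp
  qed
  then show ?thesis using that by blast
qed

lemma even_count_of_even_size:
  assumes "even (size A)" and "\<And>x. x \<noteq> a \<Longrightarrow> even (count A x)"
  shows "even (count A a)"
proof -
  have "size A = (\<Sum>x\<in>insert a (set_mset A). count A x)"
    by (simp add: size_multiset_overloaded_eq sum.insert_if not_in_iff insert_absorb)
  also have "\<dots> = count A a + (\<Sum>x\<in>set_mset A - {a}. count A x)"
    by (subst sum.insert_remove) auto
  finally show ?thesis using assms by (auto intro: dvd_sum simp: even_add)
qed

text \<open>The origin counts twice, being its own opposite.\<close>

lemma count_add_image_uminus:
  fixes A :: "'a::real_vector multiset"
  shows "count (A + image_mset uminus A) v
    = (if v = 0 then 2 else 1) * count (image_mset (\<lambda>x. {x, - x}) A) {v, - v}"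
proof (induction A)
  case (add x A)
  have eq: "{x, - x} = {v, - v} \<longleftrightarrow> x = v \<or> x = - v" by (auto simp: doubleton_eq_iff)
  have "v \<noteq> - v" if "v \<noteq> 0"
  proof
    assume "v = - v"
    then have "2 *\<^sub>R v = 0" unfolding scaleR_2 by (metis add.right_inverse)
    then show False using that by simp
  qed
  moreover have "(- x = v) = (x = - v)" by auto
  ultimately show ?case using add eq by (cases "v = 0") auto
qed simp

text \<open>With \<open>p i\<close> and \<open>- q i\<close> the values of an assignment at \<open>x i\<close> and \<open>- x i\<close>, the families \<open>h\<close> and \<open>k\<close> are
  two odd assignments such that \<open>h i + k i = p i + q i\<close>. They come from a balanced orientation of the
  multigraph whose vertices are the pairs \<open>{v, - v}\<close>: there a nonzero \<open>v\<close> has degree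
  \<open>2 * count G v\<close>, and the degree of the origin is even because the total degree is.\<close>

lemma symmetric_halves:
  fixes p q :: "nat \<Rightarrow> 'a::real_vector"
  assumes G: "image_mset p (mset_set {..<n}) + image_mset (\<lambda>i. - q i) (mset_set {..<n}) = G"
    and sym: "\<And>g. count G (- g) = count G g"
  obtains h k where "\<And>i. i < n \<Longrightarrow> (h i = p i \<and> k i = q i) \<or> (h i = q i \<and> k i = p i)"
    and "image_mset h (mset_set {..<n}) + image_mset (\<lambda>i. - h i) (mset_set {..<n}) = G"
    and "image_mset k (mset_set {..<n}) + image_mset (\<lambda>i. - k i) (mset_set {..<n}) = G"
proof -
  define \<kappa> where "\<kappa> x = {x, - x}" for x :: 'a
  define M where "M f = image_mset f (mset_set {..<n})" for f :: "nat \<Rightarrow> 'a"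
  define K where "K f = image_mset (\<lambda>i. \<kappa> (f i)) (mset_set {..<n})" for f
  have cnt: "count (M f + M (\<lambda>i. - f i)) v = (if v = 0 then 2 else 1) * count (K f) (\<kappa> v)" for f v
    using count_add_image_uminus[of "M f" v]
    by (simp add: M_def K_def \<kappa>_def multiset.map_comp comp_def)
  have neg: "count (M (\<lambda>i. - f i)) v = count (M f) (- v)" for f v
  proof -
    have "M (\<lambda>i. - f i) = image_mset uminus (M f)" by (simp add: M_def multiset.map_comp comp_def)
    moreover have "count (image_mset uminus A) v = count A (- v)" for A :: "'a multiset"
      by (induction A) (auto simp: minus_equation_iff[of _ v])
    ultimately show ?thesis by simp
  qed
  have G': "M p + M (\<lambda>i. - q i) = G" using G by (simp add: M_def)
  have pq: "(if v = 0 then 2 else 1) * (count (K p) (\<kappa> v) + count (K q) (\<kappa> v)) = 2 * count G v" for v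
  proof -
    have "(if v = 0 then 2 else 1) * (count (K p) (\<kappa> v) + count (K q) (\<kappa> v))
        = count (M p + M (\<lambda>i. - p i)) v + count (M q + M (\<lambda>i. - q i)) v"
      unfolding cnt by (simp add: distrib_left)
    also have "\<dots> = count (M p + M (\<lambda>i. - q i)) v + count (M p + M (\<lambda>i. - q i)) (- v)"
      by (simp add: neg)
    finally show ?thesis by (simp add: G' sym)
  qed
  have even: "even (count (K p + K q) u)" for u
  proof -
    have nonzero: "even (count (K p + K q) u)" if "u \<noteq> \<kappa> 0" for u
    proof (cases "u \<in># K p + K q")
      case True
      then obtain v where "u = \<kappa> v" by (auto simp: K_def)
      then show ?thesis using pq[of v] that by (cases "v = 0") auto
    qed (simp add: not_in_iff)
    then show ?thesis
      using even_count_of_even_size[of "K p + K q" "\<kappa> 0"]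
      by (cases "u = \<kappa> 0") (auto simp: K_def)
  qed
  obtain H L where HL: "\<And>i. i \<in> {..<n} \<Longrightarrow> (H i = \<kappa> (p i) \<and> L i = \<kappa> (q i)) \<or> (H i = \<kappa> (q i) \<and> L i = \<kappa> (p i))"
    and HL_eq: "image_mset H (mset_set {..<n}) = image_mset L (mset_set {..<n})"
    by (rule balanced_orientation[of "{..<n}" "\<lambda>i. \<kappa> (p i)" "\<lambda>i. \<kappa> (q i)",
          OF finite_lessThan even[unfolded K_def]]) (rule that)
  define h where "h i = (if H i = \<kappa> (p i) \<and> L i = \<kappa> (q i) then p i else q i)" for i
  define k where "k i = (if H i = \<kappa> (p i) \<and> L i = \<kappa> (q i) then q i else p i)" for i
  have hk: "(h i = p i \<and> k i = q i) \<or> (h i = q i \<and> k i = p i)" for i by (simp add: h_def k_def)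
  have "\<kappa> (h i) = H i \<and> \<kappa> (k i) = L i" if "i < n" for i
  proof (cases "H i = \<kappa> (p i) \<and> L i = \<kappa> (q i)")
    case True
    then show ?thesis unfolding h_def k_def by simp
  next
    case False
    with HL[of i] that have "H i = \<kappa> (q i) \<and> L i = \<kappa> (p i)" by simp
    with False show ?thesis unfolding h_def k_def by simp
  qed
  then have "K h = image_mset H (mset_set {..<n})" "K k = image_mset L (mset_set {..<n})"
    unfolding K_def by (auto intro!: image_mset_cong simp del: set_eq_subset)
  then have K_eq: "K h = K k" using HL_eq by simp
  have K_add: "K h + K k = K p + K q"
  proof -
    have "image_mset (\<lambda>i. f i) A + image_mset (\<lambda>i. g i) A = image_mset (\<lambda>i. f' i) A + image_mset (\<lambda>i. g' i) A"
      if "\<And>i. (f i = f' i \<and> g i = g' i) \<or> (f i = g' i \<and> g i = f' i)" for f g f' g' :: "nat \<Rightarrow> 'a set" and A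
    proof (induction A)
      case (add x A)
      then show ?case using that[of x] by auto
    qed simp
    note swap = this
    show ?thesis unfolding K_def
    proof (rule swap)
      show "(\<kappa> (h i) = \<kappa> (p i) \<and> \<kappa> (k i) = \<kappa> (q i)) \<or> (\<kappa> (h i) = \<kappa> (q i) \<and> \<kappa> (k i) = \<kappa> (p i))" for i
        using hk[of i] by (elim disjE conjE) simp_all
    qed
  qed
  have half: "M f + M (\<lambda>i. - f i) = G" if f: "K f + K f = K p + K q" for f
  proof (rule multiset_eqI)
    fix v
    have "2 * count (M f + M (\<lambda>i. - f i)) v = (if v = 0 then 2 else 1) * count (K f + K f) (\<kappa> v)"
      unfolding cnt by simp
    also have "\<dots> = 2 * count G v" unfolding f using pq[of v] by simp
    finally show "count (M f + M (\<lambda>i. - f i)) v = count G v" by simp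
  qed
  show ?thesis
    using that[of h k] hk half[of h] half[of k] K_eq K_add unfolding M_def by auto
qed

text \<open>An odd assignment is determined by its values \<open>a i\<close> at the sample points \<open>x i\<close>; these are made
  extensional so that assignments which agree on the sample are equal and the set is finite.\<close>

definition odd_assignments :: "'a::euclidean_space multiset \<Rightarrow> nat \<Rightarrow> (nat \<Rightarrow> 'a) set" where
  "odd_assignments G n = {a \<in> {..<n} \<rightarrow>\<^sub>E UNIV.
     image_mset a (mset_set {..<n}) + image_mset (\<lambda>i. - a i) (mset_set {..<n}) = G}"

lemma finite_odd_assignments: "finite (odd_assignments G n)"
proof (rule finite_subset)
  show "odd_assignments G n \<subseteq> {..<n} \<rightarrow>\<^sub>E set_mset G"
  proof
    fix a assume a: "a \<in> odd_assignments G n"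
    have "a i \<in># G" if "i < n" for i
    proof -
      have "a i \<in># image_mset a (mset_set {..<n})" using that by simp
      moreover have "G = image_mset a (mset_set {..<n}) + image_mset (\<lambda>i. - a i) (mset_set {..<n})"
        using a by (simp add: odd_assignments_def)
      ultimately show ?thesis by (metis union_iff)
    qed
    then show "a \<in> {..<n} \<rightarrow>\<^sub>E set_mset G" using a by (auto simp: odd_assignments_def PiE_iff)
  qed
qed (simp add: finite_PiE)

lemma odd_assignment_sum:
  fixes f :: "'a::euclidean_space \<Rightarrow> real"
  assumes "a \<in> odd_assignments G n" and "\<And>x. f (- x) = f x"
  shows "(\<Sum>g\<in>#G. f g) = 2 * (\<Sum>i<n. f (a i))"
proof -
  have G: "G = image_mset a (mset_set {..<n}) + image_mset (\<lambda>i. - a i) (mset_set {..<n})"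
    using assms(1) by (simp add: odd_assignments_def)
  show ?thesis unfolding G by (simp add: multiset.map_comp comp_def assms(2) sum_unfold_sum_mset)
qed

text \<open>Up to an affine change with coefficients fixed by the sample and the grid, the negative of the
  transport cost of an odd assignment.\<close>

definition score :: "nat \<Rightarrow> (nat \<Rightarrow> 'a::euclidean_space) \<Rightarrow> (nat \<Rightarrow> 'a) \<Rightarrow> real" where
  "score n x a = (\<Sum>i<n. x i \<bullet> a i)"

text \<open>The first two conditions let every odd assignment extend to a function of the points; the third one
  excludes ties.\<close>

definition generic_sample :: "'a::euclidean_space multiset \<Rightarrow> nat \<Rightarrow> (nat \<Rightarrow> 'a) \<Rightarrow> bool" where
  "generic_sample G n x \<longleftrightarrow> inj_on x {..<n} \<and> (\<forall>i<n. \<forall>j<n. x i \<noteq> - x j) \<and>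
     inj_on (score n x) (odd_assignments G n)"

lemma is_assignment_iff:
  "is_assignment G n x g \<longleftrightarrow>
     image_mset (\<lambda>i. g (x i)) (mset_set {..<n}) + image_mset (\<lambda>i. g (- x i)) (mset_set {..<n}) = G"
  by (simp add: is_assignment_def symmetrized_sample_def multiset.map_comp comp_def)

text \<open>The squared norms contribute the same amount for every assignment, so that only the inner products
  matter.\<close>

lemma transport_cost_eq:
  assumes "is_assignment G n x g"
  shows "transport_cost n x g = 2 * (\<Sum>i<n. (norm (x i))\<^sup>2) + (\<Sum>c\<in>#G. (norm c)\<^sup>2)
     - 2 * (\<Sum>i<n. x i \<bullet> (g (x i) - g (- x i)))"
proof -
  have G: "G = image_mset (\<lambda>i. g (x i)) (mset_set {..<n}) + image_mset (\<lambda>i. g (- x i)) (mset_set {..<n})"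
    using assms by (simp add: is_assignment_iff)
  have "(\<Sum>c\<in>#G. (norm c)\<^sup>2) = (\<Sum>i<n. (norm (g (x i)))\<^sup>2 + (norm (g (- x i)))\<^sup>2)"
    unfolding G by (simp add: multiset.map_comp comp_def sum_unfold_sum_mset sum_mset.distrib)
  moreover have "transport_cost n x g = (\<Sum>i<n. 2 * (norm (x i))\<^sup>2 + ((norm (g (x i)))\<^sup>2 + (norm (g (- x i)))\<^sup>2)
       - 2 * (x i \<bullet> (g (x i) - g (- x i))))"
    unfolding transport_cost_def sum.distrib[symmetric]
    by (intro sum.cong refl) (simp add: power2_norm_eq_inner inner_diff inner_add inner_commute algebra_simps)
  ultimately show ?thesis
    by (simp add: sum.distrib sum_subtractf sum_distrib_left)
qed

text \<open>The two odd assignments obtained from \<open>symmetric_halves\<close> have scores that average to the value of the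
  optimal assignment, while neither exceeds it. Both scores are therefore equal, and genericity makes the two
  assignments equal, which forces \<open>F (- x i) = - F (x i)\<close>.\<close>

lemma optimal_assignment_is_odd:
  fixes x :: "nat \<Rightarrow> 'a::euclidean_space"
  assumes sym: "\<And>g. count G (- g) = count G g"
    and generic: "generic_sample G n x"
    and opt: "is_empirical_center_outward G n x F"
  defines "a \<equiv> restrict (\<lambda>i. F (x i)) {..<n}"
  shows "a \<in> odd_assignments G n"
    and "\<And>b. b \<in> odd_assignments G n \<Longrightarrow> b \<noteq> a \<Longrightarrow> score n x b < score n x a"
proof -
  have inj: "inj_on x {..<n}" and ne: "\<And>i j. i < n \<Longrightarrow> j < n \<Longrightarrow> x i \<noteq> - x j"
    and gen: "inj_on (score n x) (odd_assignments G n)"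
    using generic by (auto simp: generic_sample_def)
  have F: "is_assignment G n x F"
    and F_min: "\<And>g. is_assignment G n x g \<Longrightarrow> transport_cost n x F \<le> transport_cost n x g"
    using opt by (auto simp: is_empirical_center_outward_def)
  define V where "V = (\<Sum>i<n. x i \<bullet> (F (x i) - F (- x i)))"
  have le: "2 * score n x b \<le> V" if b: "b \<in> odd_assignments G n" for b
  proof -
    \<comment> \<open>an odd assignment extended to a function of the points\<close>
    define g where "g y = (if y \<in> x ` {..<n} then b (inv_into {..<n} x y)
        else - b (inv_into {..<n} x (- y)))" for y
    have g: "g (x i) = b i" "g (- x i) = - b i" if "i < n" for i
    proof -
      show "g (x i) = b i" using that inj by (simp add: g_def inv_into_f_f)
      have "- x i \<notin> x ` {..<n}" using ne that by (metis imageE lessThan_iff)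
      then show "g (- x i) = - b i" using that inj by (simp add: g_def inv_into_f_f)
    qed
    have "image_mset (\<lambda>i. g (x i)) (mset_set {..<n}) = image_mset b (mset_set {..<n})"
      "image_mset (\<lambda>i. g (- x i)) (mset_set {..<n}) = image_mset (\<lambda>i. - b i) (mset_set {..<n})"
      using g by (auto intro!: image_mset_cong)
    then have asg: "is_assignment G n x g"
      using b by (simp add: is_assignment_iff odd_assignments_def)
    have "(\<Sum>i<n. x i \<bullet> (g (x i) - g (- x i))) = 2 * score n x b"
      unfolding score_def sum_distrib_left by (intro sum.cong) (auto simp: g inner_add)
    then show ?thesis
      using F_min[OF asg] unfolding transport_cost_eq[OF asg] transport_cost_eq[OF F] V_def by simp
  qed
  have halves: "image_mset (\<lambda>i. F (x i)) (mset_set {..<n}) + image_mset (\<lambda>i. - (- F (- x i))) (mset_set {..<n}) = G"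
    using F by (simp add: is_assignment_iff)
  obtain h k where
    hk: "\<And>i. i < n \<Longrightarrow> (h i = F (x i) \<and> k i = - F (- x i)) \<or> (h i = - F (- x i) \<and> k i = F (x i))"
    and h: "image_mset h (mset_set {..<n}) + image_mset (\<lambda>i. - h i) (mset_set {..<n}) = G"
    and k: "image_mset k (mset_set {..<n}) + image_mset (\<lambda>i. - k i) (mset_set {..<n}) = G"
    by (rule symmetric_halves[of "\<lambda>i. F (x i)" n "\<lambda>i. - F (- x i)" G, OF halves sym]) (rule that)
  have restr: "restrict f {..<n} \<in> odd_assignments G n"
    if "image_mset f (mset_set {..<n}) + image_mset (\<lambda>i. - f i) (mset_set {..<n}) = G" for f
  proof -
    have "image_mset (restrict f {..<n}) (mset_set {..<n}) = image_mset f (mset_set {..<n})"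
      "image_mset (\<lambda>i. - restrict f {..<n} i) (mset_set {..<n}) = image_mset (\<lambda>i. - f i) (mset_set {..<n})"
      by (auto intro!: image_mset_cong)
    then show ?thesis using that by (simp add: odd_assignments_def)
  qed
  have "x i \<bullet> h i + x i \<bullet> k i = x i \<bullet> (F (x i) - F (- x i))" if "i < n" for i
    using hk[OF that] by (auto simp: inner_diff_right)
  then have "score n x (restrict h {..<n}) + score n x (restrict k {..<n}) = V"
    unfolding score_def V_def sum.distrib[symmetric] by (intro sum.cong) auto
  then have "score n x (restrict h {..<n}) = score n x (restrict k {..<n})"
    using le[OF restr[OF h]] le[OF restr[OF k]] by linarith
  then have eq: "restrict h {..<n} = restrict k {..<n}"
    using gen restr[OF h] restr[OF k] by (auto dest: inj_onD)
  have F_odd: "h i = F (x i)" "F (- x i) = - F (x i)" if "i < n" for i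
  proof -
    have "h i = F (x i)" "- F (- x i) = F (x i)" using hk[OF that] fun_cong[OF eq, of i] that by auto
    then show "h i = F (x i)" "F (- x i) = - F (x i)" by (simp, metis minus_minus)
  qed
  then have a_eq: "a = restrict h {..<n}" by (auto simp: a_def fun_eq_iff)
  have V: "V = 2 * score n x a"
    unfolding V_def score_def sum_distrib_left
    by (intro sum.cong refl) (simp add: a_def F_odd inner_add_right)
  show a: "a \<in> odd_assignments G n" unfolding a_eq by (rule restr[OF h])
  show "score n x b < score n x a" if "b \<in> odd_assignments G n" "b \<noteq> a" for b
  proof -
    have "score n x b \<le> score n x a" using le[OF that(1)] V by simp
    moreover have "score n x b \<noteq> score n x a" using gen that a by (auto dest: inj_onD)
    ultimately show ?thesis by simp
  qed
qed

section \<open>The chi-square limit\<close>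

locale symmetric_iid_sample = prob_space M for M :: "'w measure" +
  fixes X :: "nat \<Rightarrow> 'w \<Rightarrow> real ^ 'd" and P :: "(real ^ 'd) measure"
  assumes indep: "indep_vars (\<lambda>_. borel) X UNIV"
    and ident: "\<And>i. distr M borel (X i) = P"
    and abs_cont: "absolutely_continuous lborel P"
    and symmetric: "centrally_symmetric P"
begin

lemma measurable_X [measurable]: "X i \<in> borel_measurable M"
  using indep by (auto simp: indep_vars_def)

lemma sets_P [simp, measurable_cong]: "sets P = sets borel"
  using ident[of 0] by (metis sets_distr)

lemma prob_space_P: "prob_space P"
  using prob_space_distr[OF measurable_X[of 0]] ident[of 0] by simp

lemma AE_inner_neq:
  assumes "v \<noteq> 0" shows "AE \<omega> in M. X i \<omega> \<bullet> v \<noteq> c"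
proof -
  have closed: "closed {x. v \<bullet> x = c}" by (rule closed_hyperplane)
  have "{x. v \<bullet> x = c} \<in> null_sets (completion lborel)"
    using negligible_hyperplane[of v c] assms by (simp add: negligible_iff_null_sets)
  then have "{x. v \<bullet> x = c} \<in> null_sets lborel"
    using closed by (subst (asm) null_sets_completion_iff) auto
  then have "{x. v \<bullet> x = c} \<in> null_sets P"
    using abs_cont by (auto simp: absolutely_continuous_def)
  then have "AE x in P. x \<notin> {x. v \<bullet> x = c}" by (rule AE_not_in)
  then have "AE x in P. x \<bullet> v \<noteq> c" by (simp add: inner_commute)
  then have "AE x in distr M borel (X i). x \<bullet> v \<noteq> c" unfolding ident .
  then show ?thesis by (subst (asm) AE_distr_iff) auto
qed

text \<open>One summand has a law without atoms, since hyperplanes are Lebesgue null sets, and it is independent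
  of the other summands.\<close>

lemma AE_sum_inner_nonzero:
  assumes "j < n" "v j \<noteq> 0" shows "AE \<omega> in M. (\<Sum>i<n. X i \<omega> \<bullet> v i) \<noteq> 0"
proof -
  define S where "S \<omega> = (\<Sum>i\<in>{..<n} - {j}. X i \<omega> \<bullet> v i)" for \<omega>
  have [measurable]: "S \<in> borel_measurable M" unfolding S_def[abs_def] by measurable
  have "indep_vars (\<lambda>_. borel) (\<lambda>i \<omega>. X i \<omega> \<bullet> v i) UNIV"
    by (rule indep_vars_compose2[OF indep]) simp
  then have "indep_vars (\<lambda>_. borel) (\<lambda>i \<omega>. X i \<omega> \<bullet> v i) (insert j ({..<n} - {j}))"
    by (rule indep_vars_subset) simp
  then have "indep_var borel (\<lambda>\<omega>. X j \<omega> \<bullet> v j) borel S"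
    unfolding S_def[abs_def] by (intro indep_vars_sum) auto
  then have eq: "distr M borel (\<lambda>\<omega>. X j \<omega> \<bullet> v j) \<Otimes>\<^sub>M distr M borel S
      = distr M (borel \<Otimes>\<^sub>M borel) (\<lambda>\<omega>. (X j \<omega> \<bullet> v j, S \<omega>))"
    by (simp add: indep_var_distribution_eq)
  interpret D1: prob_space "distr M borel (\<lambda>\<omega>. X j \<omega> \<bullet> v j)" by (rule prob_space_distr) simp
  interpret D2: prob_space "distr M borel S" by (rule prob_space_distr) simp
  interpret D: pair_prob_space "distr M borel (\<lambda>\<omega>. X j \<omega> \<bullet> v j)" "distr M borel S" ..
  have "AE y in distr M borel S. AE x in distr M borel (\<lambda>\<omega>. X j \<omega> \<bullet> v j). x + y \<noteq> 0"
  proof (rule AE_I2)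
    fix y
    have "AE \<omega> in M. X j \<omega> \<bullet> v j + y \<noteq> 0"
      using AE_inner_neq[OF assms(2), of j "- y"] by (auto elim!: eventually_mono)
    then show "AE x in distr M borel (\<lambda>\<omega>. X j \<omega> \<bullet> v j). x + y \<noteq> 0"
      by (subst AE_distr_iff) auto
  qed
  then have "AE x in distr M borel (\<lambda>\<omega>. X j \<omega> \<bullet> v j). AE y in distr M borel S. x + y \<noteq> 0"
    by (subst D.AE_commute; measurable)
  then have "AE p in distr M borel (\<lambda>\<omega>. X j \<omega> \<bullet> v j) \<Otimes>\<^sub>M distr M borel S. fst p + snd p \<noteq> 0"
    by (intro D.AE_pair_measure, measurable)
  then have "AE \<omega> in M. X j \<omega> \<bullet> v j + S \<omega> \<noteq> 0"
    unfolding eq by (subst (asm) AE_distr_iff) auto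
  moreover have "(\<Sum>i<n. X i \<omega> \<bullet> v i) = X j \<omega> \<bullet> v j + S \<omega>" for \<omega>
    unfolding S_def using assms(1) by (simp add: sum.remove)
  ultimately show ?thesis by simp
qed

text \<open>Each requirement excludes a single linear relation \<open>\<Sum>i<n. X i \<bullet> v i = 0\<close> with a nonzero family \<open>v\<close>, and there
  are finitely many requirements.\<close>

lemma AE_generic_sample: "AE \<omega> in M. generic_sample G n (\<lambda>i. X i \<omega>)"
proof -
  \<comment> \<open>any fixed nonzero direction serves to separate sample points\<close>
  define e :: "real ^ 'd" where "e = axis undefined 1"
  have e: "e \<noteq> 0" "2 *\<^sub>R e \<noteq> 0" by (simp_all add: e_def axis_eq_0_iff)
  have split: "(\<Sum>l<n. X l \<omega> \<bullet> ((if l = i then e else 0) + (if l = j then c *\<^sub>R e else 0)))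
      = X i \<omega> \<bullet> e + c * (X j \<omega> \<bullet> e)" if "i < n" "j < n" for i j c \<omega>
    using that by (simp add: inner_add_right sum.distrib if_distrib[of "inner _"] cong: if_cong)
  have 1: "AE \<omega> in M. i \<noteq> j \<longrightarrow> X i \<omega> \<noteq> X j \<omega>" if "i < n" "j < n" for i j
  proof (cases "i = j")
    case False
    have "AE \<omega> in M. (\<Sum>l<n. X l \<omega> \<bullet> ((if l = i then e else 0) + (if l = j then (-1) *\<^sub>R e else 0))) \<noteq> 0"
      using False e that by (intro AE_sum_inner_nonzero[of i]) auto
    then show ?thesis unfolding split[OF that] by (auto elim!: eventually_mono)
  qed simp
  have 2: "AE \<omega> in M. X i \<omega> \<noteq> - X j \<omega>" if "i < n" "j < n" for i j
  proof -
    have "AE \<omega> in M. (\<Sum>l<n. X l \<omega> \<bullet> ((if l = i then e else 0) + (if l = j then 1 *\<^sub>R e else 0))) \<noteq> 0"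
      using e that by (intro AE_sum_inner_nonzero[of i]) (auto simp flip: scaleR_2)
    then show ?thesis unfolding split[OF that] by (auto elim!: eventually_mono)
  qed
  have 3: "AE \<omega> in M. a \<noteq> b \<longrightarrow> score n (\<lambda>i. X i \<omega>) a \<noteq> score n (\<lambda>i. X i \<omega>) b"
    if "a \<in> odd_assignments G n" "b \<in> odd_assignments G n" for a b
  proof (cases "a = b")
    case False
    have "\<exists>j<n. a j \<noteq> b j"
    proof (rule ccontr)
      assume "\<not> ?thesis"
      then have "a = b" using that by (intro PiE_ext[of a "{..<n}" "\<lambda>_. UNIV" b]) (auto simp: odd_assignments_def)
      with False show False by simp
    qed
    then obtain j where j: "j < n" "a j \<noteq> b j" by blast
    have "AE \<omega> in M. (\<Sum>i<n. X i \<omega> \<bullet> (a i - b i)) \<noteq> 0"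
      using j by (intro AE_sum_inner_nonzero[of j]) auto
    then show ?thesis
      by (auto elim!: eventually_mono simp: score_def inner_diff_right sum_subtractf)
  qed simp
  have "AE \<omega> in M. \<forall>i\<in>{..<n}. \<forall>j\<in>{..<n}. (i \<noteq> j \<longrightarrow> X i \<omega> \<noteq> X j \<omega>) \<and> X i \<omega> \<noteq> - X j \<omega>"
    using 1 2 by (intro AE_finite_allI) auto
  moreover have "AE \<omega> in M. \<forall>a\<in>odd_assignments G n. \<forall>b\<in>odd_assignments G n.
      a \<noteq> b \<longrightarrow> score n (\<lambda>i. X i \<omega>) a \<noteq> score n (\<lambda>i. X i \<omega>) b"
    using 3 by (intro AE_finite_allI finite_odd_assignments) auto
  ultimately show ?thesis
    by eventually_elim (auto simp: generic_sample_def inj_on_def)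
qed

lemma distr_flipped_sample:
  assumes "n \<ge> 1" "s \<in> signs n"
  shows "distr M (\<Pi>\<^sub>M i\<in>{..<n}. borel) (\<lambda>\<omega>. \<lambda>i\<in>{..<n}. s i *\<^sub>R X i \<omega>) = (\<Pi>\<^sub>M i\<in>{..<n}. P)"
proof -
  have "indep_vars (\<lambda>_. borel) (\<lambda>i \<omega>. s i *\<^sub>R X i \<omega>) UNIV"
    by (rule indep_vars_compose2[OF indep]) simp
  then have "indep_vars (\<lambda>_. borel) (\<lambda>i \<omega>. s i *\<^sub>R X i \<omega>) {..<n}" by (rule indep_vars_subset) simp
  moreover have "{..<n} \<noteq> {}" using assms(1) by (auto simp: lessThan_empty_iff)
  ultimately have "distr M (\<Pi>\<^sub>M i\<in>{..<n}. borel) (\<lambda>\<omega>. \<lambda>i\<in>{..<n}. s i *\<^sub>R X i \<omega>)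
      = (\<Pi>\<^sub>M i\<in>{..<n}. distr M borel (\<lambda>\<omega>. s i *\<^sub>R X i \<omega>))"
    by (subst (asm) indep_vars_iff_distr_eq_PiM') auto
  also have "\<dots> = (\<Pi>\<^sub>M i\<in>{..<n}. P)"
  proof (rule PiM_cong)
    fix i assume "i \<in> {..<n}"
    then consider "s i = 1" | "s i = -1" using assms(2) by (auto simp: signs_def PiE_iff)
    then show "distr M borel (\<lambda>\<omega>. s i *\<^sub>R X i \<omega>) = P"
    proof cases
      case 2
      interpret P: prob_space P by (rule prob_space_P)
      have "distr M borel (\<lambda>\<omega>. s i *\<^sub>R X i \<omega>) = distr (distr M borel (X i)) borel uminus"
        by (subst distr_distr) (auto simp: comp_def 2)
      also have "\<dots> = distr P borel uminus" by (simp add: ident)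
      also have "\<dots> = P"
      proof (rule measure_eqI)
        fix A assume "A \<in> sets (distr P borel uminus)"
        then have A: "A \<in> sets borel" by simp
        have "emeasure (distr P borel uminus) A = emeasure P {x. - x \<in> A}"
          using A sets_eq_imp_space_eq[OF sets_P] by (subst emeasure_distr) (auto simp: vimage_def)
        also have "measure P A = measure P {x. - x \<in> A}"
          using symmetric A unfolding centrally_symmetric_def by blast
        then have "emeasure P {x. - x \<in> A} = emeasure P A"
          by (simp only: P.emeasure_eq_measure)
        finally show "emeasure (distr P borel uminus) A = emeasure P A" .
      qed simp
      finally show ?thesis .
    qed (simp add: ident)
  qed simp
  finally show ?thesis .
qed

text \<open>By genericity these events are almost surely a partition as soon as an odd assignment exists, and they do not mention \<open>F\<close>: all
  statements about the law of an arbitrary choice of optimal assignments are reduced to them.\<close>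

definition opt_prob :: "(real ^ 'd) multiset \<Rightarrow> nat \<Rightarrow> (nat \<Rightarrow> real ^ 'd) \<Rightarrow> real" where
  "opt_prob G n a = prob {\<omega> \<in> space M. \<forall>b\<in>odd_assignments G n. b \<noteq> a \<longrightarrow>
     score n (\<lambda>i. X i \<omega>) b < score n (\<lambda>i. X i \<omega>) a}"

end

definition flip :: "nat \<Rightarrow> (nat \<Rightarrow> real) \<Rightarrow> (nat \<Rightarrow> 'a::euclidean_space) \<Rightarrow> nat \<Rightarrow> 'a" where
  "flip n s a = (\<lambda>i\<in>{..<n}. s i *\<^sub>R a i)"

lemma signs_cases: "s \<in> signs n \<Longrightarrow> i < n \<Longrightarrow> s i = 1 \<or> s i = -1"
  by (auto simp: signs_def PiE_iff)

lemma flip_odd_assignments: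
  assumes s: "s \<in> signs n" and a: "a \<in> odd_assignments G n"
  shows "flip n s a \<in> odd_assignments G n"
proof -
  have "image_mset (flip n s a) A + image_mset (\<lambda>i. - flip n s a i) A
      = image_mset a A + image_mset (\<lambda>i. - a i) A" if "set_mset A \<subseteq> {..<n}" for A
    using that
  proof (induction A)
    case (add i A)
    then show ?case using signs_cases[OF s, of i] by (auto simp: flip_def)
  qed simp
  from this[of "mset_set {..<n}"] have "image_mset (flip n s a) (mset_set {..<n})
      + image_mset (\<lambda>i. - flip n s a i) (mset_set {..<n}) = G"
    using a by (simp add: odd_assignments_def)
  moreover have "flip n s a \<in> {..<n} \<rightarrow>\<^sub>E UNIV" by (simp add: flip_def)
  ultimately show ?thesis by (simp add: odd_assignments_def)
qed

lemma flip_flip: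
  assumes s: "s \<in> signs n" and a: "a \<in> odd_assignments G n"
  shows "flip n s (flip n s a) = a"
proof
  fix i
  show "flip n s (flip n s a) i = a i"
    using signs_cases[OF s, of i] a
    by (cases "i < n") (auto simp: flip_def odd_assignments_def PiE_iff extensional_def)
qed

lemma bij_flip: "s \<in> signs n \<Longrightarrow> bij_betw (flip n s) (odd_assignments G n) (odd_assignments G n)"
  by (rule bij_betw_byWitness[where f' = "flip n s"]) (auto simp: flip_flip flip_odd_assignments)

lemma score_flip: "score n x (flip n s a) = score n (\<lambda>i. s i *\<^sub>R x i) a"
  unfolding score_def by (intro sum.cong) (auto simp: flip_def)

context symmetric_iid_sample
begin

text \<open>Flipping the signs of an assignment has the same effect on its scores as flipping those of the sample,
  which leaves the law of the sample unchanged.\<close>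

lemma opt_prob_flip:
  assumes n: "n \<ge> 1" and s: "s \<in> signs n" and a: "a \<in> odd_assignments G n"
  shows "opt_prob G n (flip n s a) = opt_prob G n a"
proof -
  define Q where "Q x \<longleftrightarrow> (\<forall>b\<in>odd_assignments G n. b \<noteq> a \<longrightarrow> score n x b < score n x a)" for x
  have Q_restrict: "Q (restrict x {..<n}) = Q x" for x
    by (simp add: Q_def score_def)
  have [measurable]: "Measurable.pred (\<Pi>\<^sub>M i\<in>{..<n}. borel) Q"
    unfolding Q_def[abs_def] score_def
    by (intro pred_intros_finite finite_odd_assignments) measurable
  have law: "prob {\<omega> \<in> space M. Q (\<lambda>i. t i *\<^sub>R X i \<omega>)} = measure (\<Pi>\<^sub>M i\<in>{..<n}. P) {x \<in> space (\<Pi>\<^sub>M i\<in>{..<n}. borel). Q x}"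
    if "t \<in> signs n" for t
    unfolding distr_flipped_sample[OF n that, symmetric]
    by (subst measure_distr) (auto intro!: arg_cong[where f = prob] simp: space_PiM Q_restrict)
  have one: "(\<lambda>i\<in>{..<n}. 1) \<in> signs n" by (simp add: signs_def)
  have "opt_prob G n (flip n s a) = prob {\<omega> \<in> space M. Q (\<lambda>i. s i *\<^sub>R X i \<omega>)}"
  proof -
    have "(\<forall>b\<in>odd_assignments G n. b \<noteq> flip n s a \<longrightarrow> score n x b < score n x (flip n s a))
        \<longleftrightarrow> Q (\<lambda>i. s i *\<^sub>R x i)" for x
    proof -
      note bij = bij_flip[OF s, of G]
      have "(\<forall>b\<in>odd_assignments G n. b \<noteq> flip n s a \<longrightarrow> score n x b < score n x (flip n s a))
        \<longleftrightarrow> (\<forall>b\<in>flip n s ` odd_assignments G n. b \<noteq> flip n s a \<longrightarrow> score n x b < score n x (flip n s a))"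
        by (simp only: bij_betw_imp_surj_on[OF bij])
      also have "\<dots> \<longleftrightarrow> (\<forall>c\<in>odd_assignments G n. flip n s c \<noteq> flip n s a \<longrightarrow>
          score n x (flip n s c) < score n x (flip n s a))"
        by simp
      also have "\<dots> \<longleftrightarrow> Q (\<lambda>i. s i *\<^sub>R x i)"
        unfolding Q_def score_flip
        by (intro ball_cong refl) (simp add: inj_on_eq_iff[OF bij_betw_imp_inj_on[OF bij] _ a])
      finally show ?thesis .
    qed
    then show ?thesis by (simp add: opt_prob_def)
  qed
  also have "\<dots> = prob {\<omega> \<in> space M. Q (\<lambda>i. (\<lambda>i\<in>{..<n}. 1) i *\<^sub>R X i \<omega>)}"
    by (simp only: law[OF s] law[OF one])
  also have "\<dots> = opt_prob G n a"
    unfolding opt_prob_def Q_def by (simp add: score_def)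
  finally show ?thesis .
qed

text \<open>Almost surely exactly one of the events behind \<open>opt_prob\<close> occurs, namely that of the odd assignment
  which \<open>F\<close> induces on the sample.\<close>

lemma expectation_center_outward:
  fixes f :: "(nat \<Rightarrow> real ^ 'd) \<Rightarrow> real"
  assumes sym: "\<And>g. count G (- g) = count G g"
    and F: "AE \<omega> in M. is_empirical_center_outward G n (\<lambda>i. X i \<omega>) (F \<omega>)"
    and [measurable]: "(\<lambda>\<omega>. f (\<lambda>i\<in>{..<n}. F \<omega> (X i \<omega>))) \<in> borel_measurable M"
  shows "expectation (\<lambda>\<omega>. f (\<lambda>i\<in>{..<n}. F \<omega> (X i \<omega>)))
    = (\<Sum>a\<in>odd_assignments G n. opt_prob G n a * f a)"
proof -
  define E where "E a = {\<omega> \<in> space M. \<forall>b\<in>odd_assignments G n. b \<noteq> a \<longrightarrow>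
     score n (\<lambda>i. X i \<omega>) b < score n (\<lambda>i. X i \<omega>) a}" for a
  have [measurable]: "E a \<in> events" for a
    unfolding E_def score_def
    by (intro sets.sets_Collect_finite_All finite_odd_assignments) measurable
  have "AE \<omega> in M. f (\<lambda>i\<in>{..<n}. F \<omega> (X i \<omega>)) = (\<Sum>a\<in>odd_assignments G n. indicator (E a) \<omega> * f a)"
    using F AE_generic_sample[of G n] AE_space
  proof eventually_elim
    case (elim \<omega>)
    define a where "a = (\<lambda>i\<in>{..<n}. F \<omega> (X i \<omega>))"
    note opt = optimal_assignment_is_odd[OF sym elim(2,1), folded a_def]
    have "\<omega> \<in> E b \<longleftrightarrow> b = a" if "b \<in> odd_assignments G n" for b
      using opt that elim(3) by (auto simp: E_def dest: less_asym)
    then have "(\<Sum>b\<in>odd_assignments G n. indicator (E b) \<omega> * f b)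
        = (\<Sum>b\<in>odd_assignments G n. if b = a then f a else 0)"
      by (intro sum.cong) (auto simp: indicator_def)
    also have "\<dots> = f a" using opt(1) by (simp add: finite_odd_assignments)
    finally show ?case by (simp add: a_def)
  qed
  then have "expectation (\<lambda>\<omega>. f (\<lambda>i\<in>{..<n}. F \<omega> (X i \<omega>)))
      = expectation (\<lambda>\<omega>. \<Sum>a\<in>odd_assignments G n. indicator (E a) \<omega> * f a)"
    by (intro integral_cong_AE) auto
  also have "\<dots> = (\<Sum>a\<in>odd_assignments G n. opt_prob G n a * f a)"
    by (simp add: opt_prob_def E_def[symmetric] emeasure_eq_measure)
  finally show ?thesis .
qed

text \<open>Since \<open>opt_prob\<close> is invariant under flips, \<open>f\<close> may be replaced by its average over all sign
  patterns; it then suffices to approximate this average for each odd assignment separately.\<close>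

lemma expectation_center_outward_signs:
  fixes f :: "(nat \<Rightarrow> real ^ 'd) \<Rightarrow> real"
  assumes n: "n \<ge> 1" and sym: "\<And>g. count G (- g) = count G g"
    and F: "AE \<omega> in M. is_empirical_center_outward G n (\<lambda>i. X i \<omega>) (F \<omega>)"
    and f: "(\<lambda>\<omega>. f (\<lambda>i\<in>{..<n}. F \<omega> (X i \<omega>))) \<in> borel_measurable M"
    and close: "\<And>a. a \<in> odd_assignments G n \<Longrightarrow> \<bar>(\<Sum>s\<in>signs n. f (flip n s a)) / 2 ^ n - L\<bar> \<le> e"
  shows "\<bar>expectation (\<lambda>\<omega>. f (\<lambda>i\<in>{..<n}. F \<omega> (X i \<omega>))) - L\<bar> \<le> e"
proof -
  let ?O = "odd_assignments G n"
  have total: "(\<Sum>a\<in>?O. opt_prob G n a) = 1"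
    using expectation_center_outward[OF sym F, of "\<lambda>_. 1"] prob_space by simp
  have nonneg: "0 \<le> opt_prob G n a" for a by (simp add: opt_prob_def)
  have flipped: "(\<Sum>a\<in>?O. opt_prob G n a * f (flip n s a)) = (\<Sum>a\<in>?O. opt_prob G n a * f a)"
    if "s \<in> signs n" for s
  proof -
    have "(\<Sum>a\<in>?O. opt_prob G n a * f (flip n s a)) = (\<Sum>a\<in>?O. opt_prob G n (flip n s a) * f (flip n s a))"
      by (intro sum.cong refl) (simp add: opt_prob_flip[OF n that])
    also have "\<dots> = (\<Sum>a\<in>?O. opt_prob G n a * f a)"
      by (rule sum.reindex_bij_betw[OF bij_flip[OF that]])
    finally show ?thesis .
  qed
  have "(\<Sum>a\<in>?O. opt_prob G n a * ((\<Sum>s\<in>signs n. f (flip n s a)) / 2 ^ n))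
      = (\<Sum>s\<in>signs n. \<Sum>a\<in>?O. opt_prob G n a * f (flip n s a)) / 2 ^ n"
    by (subst sum.swap) (simp add: sum_distrib_left sum_divide_distrib)
  also have "\<dots> = (\<Sum>a\<in>?O. opt_prob G n a * f a)" by (simp add: flipped)
  also have "\<dots> = expectation (\<lambda>\<omega>. f (\<lambda>i\<in>{..<n}. F \<omega> (X i \<omega>)))"
    by (rule expectation_center_outward[OF sym F f, symmetric])
  finally have "expectation (\<lambda>\<omega>. f (\<lambda>i\<in>{..<n}. F \<omega> (X i \<omega>))) - L
      = (\<Sum>a\<in>?O. opt_prob G n a * ((\<Sum>s\<in>signs n. f (flip n s a)) / 2 ^ n - L))"
    using total by (simp add: right_diff_distrib sum_subtractf flip: sum_distrib_right)
  also have "\<bar>\<dots>\<bar> \<le> (\<Sum>a\<in>?O. opt_prob G n a * e)"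
    using close nonneg by (intro order_trans[OF sum_abs] sum_mono) (simp add: abs_mult mult_left_mono)
  also have "\<dots> = e" using total by (simp flip: sum_distrib_right)
  finally show ?thesis .
qed

text \<open>The two statistics are the cases where \<open>\<phi>\<close> is the identity and where it is \<open>sgn\<close>. The limiting
  covariance matrix of the transformed grid points is the identity divided by \<open>c\<close>, whence the factor \<open>c\<close>.\<close>

theorem chi_square_limit:
  fixes G :: "nat \<Rightarrow> (real ^ 'd) multiset" and F :: "nat \<Rightarrow> 'w \<Rightarrow> real ^ 'd \<Rightarrow> real ^ 'd"
    and \<phi> :: "real ^ 'd \<Rightarrow> real ^ 'd"
  assumes grid: "\<And>n. n \<ge> 1 \<Longrightarrow> is_grid (2 * n) (G n)"
    and grid_symmetric: "\<And>n g. n \<ge> 1 \<Longrightarrow> g \<in># G n \<Longrightarrow> - g \<in># G n"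
    and F: "\<And>n. n \<ge> 1 \<Longrightarrow> AE \<omega> in M. is_empirical_center_outward (G n) n (\<lambda>i. X i \<omega>) (F n \<omega>)"
    and F_measurable: "\<And>n i. i < n \<Longrightarrow> (\<lambda>\<omega>. F n \<omega> (X i \<omega>)) \<in> borel_measurable M"
    and \<phi> [measurable]: "\<phi> \<in> borel_measurable borel" and \<phi>_odd: "\<And>x. \<phi> (- x) = - \<phi> x"
    and \<phi>_le: "\<And>x. norm x \<le> 1 \<Longrightarrow> norm (\<phi> x) \<le> 1"
    and c: "c > 0"
    and second_moment: "\<And>z. (\<lambda>n. \<integral>g. (z \<bullet> \<phi> g)\<^sup>2 \<partial>grid_distribution (G n)) \<longlonglongrightarrow> (norm z)\<^sup>2 / c"
  shows "weak_conv_m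
    (\<lambda>n. distr M borel (\<lambda>\<omega>. c * (norm ((1 / sqrt (real n)) *\<^sub>R (\<Sum>i<n. \<phi> (F n \<omega> (X i \<omega>)))))\<^sup>2))
    (chi_square CARD('d))"
proof -
  interpret gauss: prob_space "std_gaussian :: (real ^ 'd) measure" by (rule prob_space_std_gaussian)
  define T where "T n \<omega> = (1 / sqrt (real n)) *\<^sub>R (\<Sum>i<n. \<phi> (F n \<omega> (X i \<omega>)))" for n \<omega>
  have T [measurable]: "T n \<in> borel_measurable M" for n
    unfolding T_def[abs_def]
    by (intro borel_measurable_scaleR borel_measurable_const borel_measurable_sum measurable_compose[OF F_measurable \<phi>]) auto
  define q where "q n z = (\<integral>g. (z \<bullet> \<phi> g)\<^sup>2 \<partial>grid_distribution (G n))" for n z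
  have [measurable]: "q n \<in> borel_measurable borel" for n
  proof -
    interpret g: prob_space "grid_distribution (G n)" by (rule prob_space_grid_distribution)
    show ?thesis unfolding q_def[abs_def] by measurable
  qed
  have q_nonneg: "0 \<le> q n z" for n z unfolding q_def by simp
  have count_symmetric: "count (G n) (- g) = count (G n) g" if n: "n \<ge> 1" for n g
  proof (cases "g = 0")
    case False
    then have "count (G n) g \<le> 1" "count (G n) (- g) \<le> 1"
      using grid[OF n] by (auto simp: is_grid_def)
    moreover have "g \<in># G n \<longleftrightarrow> - g \<in># G n" using grid_symmetric[OF n] by (metis minus_minus)
    ultimately show ?thesis
      by (metis One_nat_def count_greater_eq_one_iff le_antisym not_in_iff)
  qed simp
  have close: "\<bar>expectation (\<lambda>\<omega>. exp (- \<kappa> * (norm (T n \<omega>))\<^sup>2)) - (\<integral>z. exp (- \<kappa> * q n z) \<partial>std_gaussian)\<bar>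
      \<le> (\<integral>z. min 2 (4 * \<kappa>\<^sup>2 * norm z ^ 4 / n) \<partial>(std_gaussian :: (real ^ 'd) measure))"
    if \<kappa>: "\<kappa> \<ge> 0" and n: "n \<ge> 1" for \<kappa> n
  proof -
    define f where "f a = exp (- \<kappa> * (norm ((1 / sqrt (real n)) *\<^sub>R (\<Sum>i<n. \<phi> (a i))))\<^sup>2)" for a
    have f_F: "f (\<lambda>i\<in>{..<n}. F n \<omega> (X i \<omega>)) = exp (- \<kappa> * (norm (T n \<omega>))\<^sup>2)" for \<omega>
      by (simp add: f_def T_def)
    have "\<bar>(\<Sum>s\<in>signs n. f (flip n s a)) / 2 ^ n - (\<integral>z. exp (- \<kappa> * q n z) \<partial>std_gaussian)\<bar>
        \<le> (\<integral>z. min 2 (4 * \<kappa>\<^sup>2 * norm z ^ 4 / n) \<partial>(std_gaussian :: (real ^ 'd) measure))"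
      if a: "a \<in> odd_assignments (G n) n" for a
    proof -
      have \<phi>_flip: "\<phi> (flip n s a i) = s i *\<^sub>R \<phi> (a i)" if "s \<in> signs n" "i < n" for s i
        using signs_cases[OF that] that(2) by (auto simp: flip_def \<phi>_odd)
      have "f (flip n s a) = exp (- \<kappa> * (norm ((1 / sqrt n) *\<^sub>R (\<Sum>i<n. s i *\<^sub>R \<phi> (a i))))\<^sup>2)"
        if "s \<in> signs n" for s
        using that by (simp add: f_def \<phi>_flip)
      moreover have "q n z = (\<Sum>i<n. (z \<bullet> \<phi> (a i))\<^sup>2) / n" for z
      proof -
        have "q n z = (\<Sum>g\<in>#G n. (z \<bullet> \<phi> g)\<^sup>2) / (2 * n)"
          unfolding q_def using integral_grid_distribution[OF grid[OF n], of "\<lambda>g. (z \<bullet> \<phi> g)\<^sup>2"] n by simp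
        also have "(\<Sum>g\<in>#G n. (z \<bullet> \<phi> g)\<^sup>2) = 2 * (\<Sum>i<n. (z \<bullet> \<phi> (a i))\<^sup>2)"
          by (rule odd_assignment_sum[OF a]) (simp add: \<phi>_odd)
        finally show ?thesis by simp
      qed
      moreover have "norm (\<phi> (a i)) \<le> 1" if "i < n" for i
      proof -
        have "a i \<in># image_mset a (mset_set {..<n})" using that by simp
        moreover have "G n = image_mset a (mset_set {..<n}) + image_mset (\<lambda>i. - a i) (mset_set {..<n})"
          using a by (simp add: odd_assignments_def)
        ultimately have "a i \<in># G n" by (metis union_iff)
        then have "a i \<in> cball 0 1" using grid[OF n] by (auto simp: is_grid_def)
        then show ?thesis by (intro \<phi>_le) simp
      qed
      ultimately show ?thesis
        using average_laplace_signs_gaussian_bound[OF \<kappa>, of n "\<lambda>i. \<phi> (a i)"] by simp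
    qed
    note average = this
    have "(\<lambda>\<omega>. f (\<lambda>i\<in>{..<n}. F n \<omega> (X i \<omega>))) \<in> borel_measurable M"
      unfolding f_F by measurable
    from expectation_center_outward_signs[OF n count_symmetric[OF n] F[OF n] this average]
    show ?thesis unfolding f_F .
  qed
  have limit: "(\<lambda>n. expectation (\<lambda>\<omega>. exp (- \<kappa> * (norm (T n \<omega>))\<^sup>2)))
      \<longlonglongrightarrow> (\<integral>z. exp (- \<kappa> * ((norm z)\<^sup>2 / c)) \<partial>(std_gaussian :: (real ^ 'd) measure))" if "\<kappa> \<ge> 0" for \<kappa>
  proof -
    have "(\<lambda>n. expectation (\<lambda>\<omega>. exp (- \<kappa> * (norm (T n \<omega>))\<^sup>2)) - (\<integral>z. exp (- \<kappa> * q n z) \<partial>std_gaussian)) \<longlonglongrightarrow> 0"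
    proof (rule Lim_null_comparison)
      show "\<forall>\<^sub>F n in sequentially. norm (expectation (\<lambda>\<omega>. exp (- \<kappa> * (norm (T n \<omega>))\<^sup>2)) - (\<integral>z. exp (- \<kappa> * q n z) \<partial>std_gaussian))
          \<le> (\<integral>z. min 2 (4 * \<kappa>\<^sup>2 * norm z ^ 4 / n) \<partial>(std_gaussian :: (real ^ 'd) measure))"
        using eventually_ge_at_top[of 1]
      proof eventually_elim
        case (elim n)
        then show ?case unfolding real_norm_def by (rule close[OF that])
      qed
    qed (rule average_laplace_signs_error_tendsto_0)
    moreover have "(\<lambda>n. \<integral>z. exp (- \<kappa> * q n z) \<partial>std_gaussian)
        \<longlonglongrightarrow> (\<integral>z. exp (- \<kappa> * ((norm z)\<^sup>2 / c)) \<partial>(std_gaussian :: (real ^ 'd) measure))"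
    proof (rule integral_dominated_convergence[where w = "\<lambda>_. 1"])
      show "AE z in std_gaussian. (\<lambda>n. exp (- \<kappa> * q n z)) \<longlonglongrightarrow> exp (- \<kappa> * ((norm z)\<^sup>2 / c))"
        unfolding q_def by (intro AE_I2 tendsto_intros second_moment)
      show "AE z in std_gaussian. norm (exp (- \<kappa> * q n z)) \<le> 1" for n
        using q_nonneg that by auto
    qed auto
    ultimately show ?thesis using tendsto_add by fastforce
  qed
  show ?thesis unfolding T_def[symmetric]
  proof (rule weak_conv_m_of_laplace_transforms)
    show "real_distribution (distr M borel (\<lambda>\<omega>. c * (norm (T n \<omega>))\<^sup>2))" for n
      by (rule real_distribution_distr) measurable
    show "real_distribution (chi_square CARD('d))"
      unfolding chi_square_eq_distr_std_gaussian by (rule gauss.real_distribution_distr) measurable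
    show "AE w in distr M borel (\<lambda>\<omega>. c * (norm (T n \<omega>))\<^sup>2). 0 \<le> w" for n
      using c by (subst AE_distr_iff) auto
    show "AE w in chi_square CARD('d). 0 \<le> w"
      unfolding chi_square_eq_distr_std_gaussian by (subst AE_distr_iff) auto
    fix k :: nat
    have "(\<integral>w. exp (- real k * w) \<partial>distr M borel (\<lambda>\<omega>. c * (norm (T n \<omega>))\<^sup>2))
        = expectation (\<lambda>\<omega>. exp (- (real k * c) * (norm (T n \<omega>))\<^sup>2))" for n
      by (subst integral_distr) (auto simp: mult.assoc)
    moreover have "(\<integral>w. exp (- real k * w) \<partial>chi_square CARD('d))
        = (\<integral>z. exp (- (real k * c) * ((norm z)\<^sup>2 / c)) \<partial>(std_gaussian :: (real ^ 'd) measure))"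
      unfolding chi_square_eq_distr_std_gaussian using c by (subst integral_distr) auto
    ultimately show "(\<lambda>n. \<integral>w. exp (- real k * w) \<partial>distr M borel (\<lambda>\<omega>. c * (norm (T n \<omega>))\<^sup>2))
        \<longlonglongrightarrow> (\<integral>w. exp (- real k * w) \<partial>chi_square CARD('d))"
      using limit[of "real k * c"] c by simp
  qed
qed

end


lemma center_outward_sign_eq_sgn: "center_outward_sign F x = sgn (F x)"
  by (simp add: center_outward_sign_def sgn_div_norm)

theorem proposition5:
  fixes M :: "'w measure"
    and X :: "nat \<Rightarrow> 'w \<Rightarrow> real ^ 'd"
    and P :: "(real ^ 'd) measure"
    and G :: "nat \<Rightarrow> (real ^ 'd) multiset"
    and F :: "nat \<Rightarrow> 'w \<Rightarrow> real ^ 'd \<Rightarrow> real ^ 'd"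
  assumes prob_space: "prob_space M"
    and independent: "prob_space.indep_vars M (\<lambda>_. borel) X UNIV"
    and identically_distributed: "\<And>i. distr M borel (X i) = P"
    and abs_continuous: "absolutely_continuous lborel P"
    and symmetric: "centrally_symmetric P"
    and grid: "\<And>n. n \<ge> 1 \<Longrightarrow> is_grid (2 * n) (G n)"
    and grid_symmetric: "\<And>n g. n \<ge> 1 \<Longrightarrow> g \<in># G n \<Longrightarrow> - g \<in># G n"
    and grid_conv: "weakly_converges (\<lambda>n. grid_distribution (G n)) spherical_uniform"
    \<comment> \<open>almost surely: on the null event of coinciding sample points no assignment need exist\<close>
    and F: "\<And>n. n \<ge> 1 \<Longrightarrow>
      AE \<omega> in M. is_empirical_center_outward (G n) n (\<lambda>i. X i \<omega>) (F n \<omega>)"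
    and F_measurable: "\<And>n i. i < n \<Longrightarrow> (\<lambda>\<omega>. F n \<omega> (X i \<omega>)) \<in> borel_measurable M"
  shows
    "(\<forall>n\<ge>1. \<forall>\<omega>. real CARD('d) * (norm (T_sign n (\<lambda>i. X i \<omega>) (F n \<omega>)))\<^sup>2
        = real CARD('d) / real n *
            (norm (\<Sum>i<n. center_outward_sign (F n \<omega>) (X i \<omega>)))\<^sup>2) \<and>
     weak_conv_m
       (\<lambda>n. distr M borel (\<lambda>\<omega>. real CARD('d) * (norm (T_sign n (\<lambda>i. X i \<omega>) (F n \<omega>)))\<^sup>2))
       (chi_square CARD('d)) \<and>
     (\<forall>n\<ge>1. \<forall>\<omega>. 3 * real CARD('d) * (norm (T_distribution n (\<lambda>i. X i \<omega>) (F n \<omega>)))\<^sup>2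
        = 3 * real CARD('d) / real n * (norm (\<Sum>i<n. F n \<omega> (X i \<omega>)))\<^sup>2) \<and>
     weak_conv_m
       (\<lambda>n. distr M borel (\<lambda>\<omega>. 3 * real CARD('d) * (norm (T_distribution n (\<lambda>i. X i \<omega>) (F n \<omega>)))\<^sup>2))
       (chi_square CARD('d))"
proof (intro conjI allI impI)
  interpret symmetric_iid_sample M X P
    using prob_space independent identically_distributed abs_continuous symmetric
    by (simp add: symmetric_iid_sample_def symmetric_iid_sample_axioms_def)
  have grid_prob: "prob_space (grid_distribution (G n))" for n by (rule prob_space_grid_distribution)
  have second_moment: "(\<lambda>n. \<integral>g. (z \<bullet> g)\<^sup>2 \<partial>grid_distribution (G n)) \<longlonglongrightarrow> (norm z)\<^sup>2 / (3 * real CARD('d))" for z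
  proof -
    \<comment> \<open>the truncation leaves the quadratic form unchanged on the unit ball, where all grid points lie\<close>
    define h where "h g = min ((z \<bullet> g)\<^sup>2) ((norm z)\<^sup>2)" for g
    have h: "h g = (z \<bullet> g)\<^sup>2" if "norm g \<le> 1" for g
    proof -
      have "\<bar>z \<bullet> g\<bar> \<le> norm z" using Cauchy_Schwarz_ineq2[of z g] mult_left_mono[OF that, of "norm z"] by simp
      then show ?thesis using power_mono[of "\<bar>z \<bullet> g\<bar>" "norm z" 2] by (simp add: h_def)
    qed
    have cont: "continuous_on UNIV h" unfolding h_def[abs_def] by (intro continuous_intros)
    have "bounded (range h)"
      unfolding bounded_iff h_def by (intro exI[of _ "(norm z)\<^sup>2"]) auto
    with cont have "(\<lambda>n. \<integral>g. h g \<partial>grid_distribution (G n)) \<longlonglongrightarrow> (\<integral>g. h g \<partial>spherical_uniform)"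
      using grid_conv unfolding weakly_converges_def by blast
    also have "(\<integral>g. h g \<partial>spherical_uniform) = (norm z)\<^sup>2 / (3 * real CARD('d))"
      using second_moment_spherical_uniform[of h z] h borel_measurable_continuous_onI[OF cont] by simp
    finally show ?thesis
    proof (rule Lim_transform_eventually)
      show "\<forall>\<^sub>F n in sequentially. (\<integral>g. h g \<partial>grid_distribution (G n)) = (\<integral>g. (z \<bullet> g)\<^sup>2 \<partial>grid_distribution (G n))"
        using eventually_ge_at_top[of 1]
      proof eventually_elim
        case (elim n)
        have "h g = (z \<bullet> g)\<^sup>2" if "g \<in># G n" for g
          using grid[OF elim] that by (intro h) (auto simp: is_grid_def)
        then have "(\<Sum>g\<in>#G n. h g) = (\<Sum>g\<in>#G n. (z \<bullet> g)\<^sup>2)"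
          by (intro arg_cong[where f = sum_mset] image_mset_cong)
        then show ?case
          using elim borel_measurable_continuous_onI[OF cont] by (simp add: integral_grid_distribution[OF grid[OF elim]])
      qed
    qed
  qed
  have sign_second_moment:
    "(\<lambda>n. \<integral>g. (z \<bullet> sgn g)\<^sup>2 \<partial>grid_distribution (G n)) \<longlonglongrightarrow> (norm z)\<^sup>2 / real CARD('d)" for z
    unfolding sign_second_moment_spherical_uniform[symmetric]
  proof (rule weakly_converges_discontinuous_at_0[OF grid_conv grid_prob _ prob_space_spherical_uniform _ AE_spherical_uniform_nonzero])
    show "continuous_on (- {0}) (\<lambda>g. (z \<bullet> sgn g)\<^sup>2)"
      unfolding sgn_div_norm by (intro continuous_intros) auto
    fix g
    have "\<bar>z \<bullet> sgn g\<bar> \<le> norm z"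
      using Cauchy_Schwarz_ineq2[of z "sgn g"] by (auto simp: norm_sgn split: if_splits)
    then show "\<bar>(z \<bullet> sgn g)\<^sup>2\<bar> \<le> (norm z)\<^sup>2" using power_mono[of "\<bar>z \<bullet> sgn g\<bar>" "norm z" 2] by simp
  qed auto
  show "weak_conv_m
       (\<lambda>n. distr M borel (\<lambda>\<omega>. real CARD('d) * (norm (T_sign n (\<lambda>i. X i \<omega>) (F n \<omega>)))\<^sup>2))
       (chi_square CARD('d))"
    unfolding T_sign_def center_outward_sign_eq_sgn
    by (rule chi_square_limit[OF grid grid_symmetric F F_measurable _ _ _ _ sign_second_moment])
       (auto simp: sgn_minus norm_sgn)
  show "weak_conv_m
       (\<lambda>n. distr M borel (\<lambda>\<omega>. 3 * real CARD('d) * (norm (T_distribution n (\<lambda>i. X i \<omega>) (F n \<omega>)))\<^sup>2))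
       (chi_square CARD('d))"
    unfolding T_distribution_def
    by (rule chi_square_limit[OF grid grid_symmetric F F_measurable _ _ _ _ second_moment]) auto
qed (simp_all add: T_sign_def T_distribution_def power_mult_distrib power_divide)

end
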